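(* There is an algorithm that, given a proper circular-arc graph $G$ on $n\ge 3$ vertices together with a proper intersection model $F$ of $G$ in which every arc has density at least $2$, determines in linear time whether $G$ has a locally connected spanning tree, and produces one if the answer is positive.
   Context: A circular-arc graph $G$ is the intersection graph of a family $F$ of arcs on a circle: each vertex $v$ corresponds to an arc $a(v)\in F$, and two vertices are adjacent iff their arcs overlap. All arc endpoints are assumed distinct and no arc covers the entire circle. $F$ is proper if no arc of $F$ is contained in another; $G$ is a proper circular-arc graph if it has a proper such model. The arc $a(v)$ begins at its head $h(v)$ and ends at its tail $t(v)$ in a counterclockwise traversal; the density $d(v)$ is the number of arcs of $F$ (including $a(v)$) containing $h(v)$. A locally connected spanning tree of $G$ is a spanning tree $T$ of $G$ such that for every vertex $v$, the set of neighbors of $v$ in $T$ induces a connected subgraph of $G$. *)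

theory Defs
  imports "HOL-Analysis.Complex_Transcendental"
begin

section \<open>Graphs and locally connected spanning trees\<close>

text \<open>
  A finite simple graph is a vertex set \<open>V\<close> with a set \<open>E\<close> of two-element subsets of \<open>V\<close>.
  (\<open>Graph_Theory.spanning_tree\<close> is not usable for undirected graphs represented by symmetric
  arc sets: there every pair of opposite arcs is a cycle.)
\<close>

text \<open>\<open>connected_graph S E\<close> only walks along edges inside \<open>S\<close>: for a subset \<open>S\<close> of the vertices it
  says that the subgraph induced by \<open>S\<close> is connected.\<close>

definition connected_graph :: "'a set \<Rightarrow> 'a set set \<Rightarrow> bool" where
  "connected_graph S E \<longleftrightarrow>
     S \<noteq> {} \<and> (\<forall>u\<in>S. \<forall>v\<in>S. (u, v) \<in> {(x, y). x \<in> S \<and> y \<in> S \<and> {x, y} \<in> E}\<^sup>*)"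

definition cycle_in :: "'a set set \<Rightarrow> 'a list \<Rightarrow> bool" where
  "cycle_in E vs \<longleftrightarrow>
     3 \<le> length vs \<and> distinct vs \<and>
     (\<forall>i < length vs. {vs ! i, vs ! (Suc i mod length vs)} \<in> E)"

definition tree_graph :: "'a set \<Rightarrow> 'a set set \<Rightarrow> bool" where
  "tree_graph V T \<longleftrightarrow> connected_graph V T \<and> (\<nexists>vs. cycle_in T vs)"

definition spanning_tree :: "'a set \<Rightarrow> 'a set set \<Rightarrow> 'a set set \<Rightarrow> bool" where
  "spanning_tree V E T \<longleftrightarrow> T \<subseteq> E \<and> tree_graph V T"

definition neighbours :: "'a set set \<Rightarrow> 'a \<Rightarrow> 'a set" where
  "neighbours E v = {u. {u, v} \<in> E}"

definition locally_connected_spanning_tree :: "'a set \<Rightarrow> 'a set set \<Rightarrow> 'a set set \<Rightarrow> bool" where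
  "locally_connected_spanning_tree V E T \<longleftrightarrow>
     spanning_tree V E T \<and> (\<forall>v\<in>V. connected_graph (neighbours T v) E)"

section \<open>Circular-arc models\<close>

text \<open>The closed arc of the unit circle traversed counterclockwise from \<open>p\<close> to \<open>q\<close>. Arcs are closed so
  that an arc contains its own head; as all endpoints of a model are distinct, closed and open arcs
  otherwise give the same intersections, containments and densities.\<close>

definition ccw_arc :: "complex \<Rightarrow> complex \<Rightarrow> complex set" where
  "ccw_arc p q = {z \<in> sphere 0 1. Arg2pi (z / p) \<le> Arg2pi (q / p)}"

definition arc_family :: "'a set \<Rightarrow> ('a \<Rightarrow> complex) \<Rightarrow> ('a \<Rightarrow> complex) \<Rightarrow> bool" where
  "arc_family V h t \<longleftrightarrow>
     h ` V \<subseteq> sphere 0 1 \<and> t ` V \<subseteq> sphere 0 1 \<and>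
     inj_on h V \<and> inj_on t V \<and> h ` V \<inter> t ` V = {} \<and>
     (\<forall>v\<in>V. ccw_arc (h v) (t v) \<noteq> sphere 0 1)"

definition intersection_model ::
    "'a set \<Rightarrow> 'a set set \<Rightarrow> ('a \<Rightarrow> complex) \<Rightarrow> ('a \<Rightarrow> complex) \<Rightarrow> bool" where
  "intersection_model V E h t \<longleftrightarrow>
     arc_family V h t \<and>
     E = {{u, v} | u v. u \<in> V \<and> v \<in> V \<and> u \<noteq> v \<and>
                        ccw_arc (h u) (t u) \<inter> ccw_arc (h v) (t v) \<noteq> {}}"

definition proper_model ::
    "'a set \<Rightarrow> 'a set set \<Rightarrow> ('a \<Rightarrow> complex) \<Rightarrow> ('a \<Rightarrow> complex) \<Rightarrow> bool" where
  "proper_model V E h t \<longleftrightarrow>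
     intersection_model V E h t \<and>
     (\<forall>u\<in>V. \<forall>v\<in>V. u \<noteq> v \<longrightarrow> \<not> ccw_arc (h u) (t u) \<subseteq> ccw_arc (h v) (t v))"

definition density :: "'a set \<Rightarrow> ('a \<Rightarrow> complex) \<Rightarrow> ('a \<Rightarrow> complex) \<Rightarrow> 'a \<Rightarrow> nat" where
  "density V h t v = card {u \<in> V. h v \<in> ccw_arc (h u) (t u)}"

section \<open>Algorithms: random access machine programs with uniform cost\<close>

text \<open>
  A program uses finitely many registers and finitely many arrays (both addressed by name) holding
  natural numbers. Addition, truncated subtraction and comparison are the only arithmetic; every
  operation, memory access and control step costs one time unit.
\<close>

type_synonym name = string

record state =
  reg :: "name \<Rightarrow> nat"
  arr :: "name \<Rightarrow> nat \<Rightarrow> nat"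

datatype aexp = Const nat | Var name | Elem name aexp | Plus aexp aexp | Minus aexp aexp

datatype bexp = Less aexp aexp | Equal aexp aexp | BNot bexp | BAnd bexp bexp

datatype com =
    Skip
  | Assign name aexp
  | Store name aexp aexp
  | Seq com com
  | Cond bexp com com
  | While bexp com

primrec aval :: "aexp \<Rightarrow> state \<Rightarrow> nat" where
  "aval (Const k) s = k"
| "aval (Var x) s = reg s x"
| "aval (Elem a e) s = arr s a (aval e s)"
| "aval (Plus e f) s = aval e s + aval f s"
| "aval (Minus e f) s = aval e s - aval f s"

primrec acost :: "aexp \<Rightarrow> nat" where
  "acost (Const k) = 1"
| "acost (Var x) = 1"
| "acost (Elem a e) = acost e + 1"
| "acost (Plus e f) = acost e + acost f + 1"
| "acost (Minus e f) = acost e + acost f + 1"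

primrec bval :: "bexp \<Rightarrow> state \<Rightarrow> bool" where
  "bval (Less e f) s \<longleftrightarrow> aval e s < aval f s"
| "bval (Equal e f) s \<longleftrightarrow> aval e s = aval f s"
| "bval (BNot b) s \<longleftrightarrow> \<not> bval b s"
| "bval (BAnd b c) s \<longleftrightarrow> bval b s \<and> bval c s"

primrec bcost :: "bexp \<Rightarrow> nat" where
  "bcost (Less e f) = acost e + acost f + 1"
| "bcost (Equal e f) = acost e + acost f + 1"
| "bcost (BNot b) = bcost b + 1"
| "bcost (BAnd b c) = bcost b + bcost c + 1"

text \<open>\<open>exec c s k s'\<close>: started in \<open>s\<close>, the program \<open>c\<close> halts in \<open>s'\<close> after \<open>k\<close> time units.\<close>

inductive exec :: "com \<Rightarrow> state \<Rightarrow> nat \<Rightarrow> state \<Rightarrow> bool" where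
  Skip: "exec Skip s 1 s"
| Assign: "exec (Assign x e) s (acost e + 1) (s\<lparr>reg := (reg s)(x := aval e s)\<rparr>)"
| Store: "exec (Store a e f) s (acost e + acost f + 1)
            (s\<lparr>arr := (arr s)(a := (arr s a)(aval e s := aval f s))\<rparr>)"
| Seq: "exec c s j s' \<Longrightarrow> exec d s' k s'' \<Longrightarrow> exec (Seq c d) s (j + k) s''"
| CondTrue: "bval b s \<Longrightarrow> exec c s k s' \<Longrightarrow> exec (Cond b c d) s (bcost b + k + 1) s'"
| CondFalse: "\<not> bval b s \<Longrightarrow> exec d s k s' \<Longrightarrow> exec (Cond b c d) s (bcost b + k + 1) s'"
| WhileFalse: "\<not> bval b s \<Longrightarrow> exec (While b c) s (bcost b + 1) s"
| WhileTrue: "bval b s \<Longrightarrow> exec c s j s' \<Longrightarrow> exec (While b c) s' k s'' \<Longrightarrow>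
              exec (While b c) s (bcost b + j + k + 1) s''"

inductive_cases SkipE: "exec Skip s k s'"
  and AssignE: "exec (Assign x e) s k s'"
  and StoreE: "exec (Store a e f) s k s'"
  and SeqE: "exec (Seq c d) s k s'"
  and CondE: "exec (Cond b c d) s k s'"
  and WhileE: "exec (While b c) s k s'"

lemma exec_deterministic: "exec c s k s' \<Longrightarrow> exec c s k' s'' \<Longrightarrow> k = k' \<and> s' = s''"
proof (induction arbitrary: k' s'' rule: exec.induct)
  case (Skip s)
  then show ?case by (auto elim: SkipE)
next
  case (Assign x e s)
  then show ?case by (auto elim: AssignE)
next
  case (Store a e f s)
  then show ?case by (auto elim: StoreE)
next
  case (Seq c s j s1 d k s2)
  from Seq.prems obtain j' k1 s1' where
    "k' = j' + k1" "exec c s j' s1'" "exec d s1' k1 s''" by (rule SeqE)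
  with Seq.IH(1)[of j' s1'] Seq.IH(2)[of k1 s''] show ?case by simp
next
  case (CondTrue b s c k s1 d)
  from CondTrue.prems CondTrue.hyps(1) obtain k1 where
    "k' = bcost b + k1 + 1" "exec c s k1 s''" by (auto elim: CondE)
  with CondTrue.IH[of k1 s''] show ?case by simp
next
  case (CondFalse b s d k s1 c)
  from CondFalse.prems CondFalse.hyps(1) obtain k1 where
    "k' = bcost b + k1 + 1" "exec d s k1 s''" by (auto elim: CondE)
  with CondFalse.IH[of k1 s''] show ?case by simp
next
  case (WhileFalse b s c)
  from WhileFalse.prems WhileFalse.hyps show ?case by (auto elim: WhileE)
next
  case (WhileTrue b s c j s1 k s2)
  from WhileTrue.prems WhileTrue.hyps(1) obtain j' k1 s1' where
    "k' = bcost b + j' + k1 + 1" "exec c s j' s1'" "exec (While b c) s1' k1 s''"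
    by (auto elim: WhileE)
  with WhileTrue.IH(1)[of j' s1'] WhileTrue.IH(2)[of k1 s''] show ?case by simp
qed

section \<open>Input and output conventions\<close>

text \<open>
  The vertices are \<open>0, \<dots>, n - 1\<close>.

  The graph is given by adjacency lists in arbitrary order: the neighbours of \<open>v\<close> are stored in the
  cells \<open>off v, \<dots>, off (v + 1) - 1\<close> of the array \<open>adj\<close>.

  The model is given by the counterclockwise sequence of its \<open>2 n\<close> endpoints, starting anywhere:
  the \<open>i\<close>-th endpoint belongs to the arc of vertex \<open>own i\<close> and is its head if \<open>kind i = 0\<close> and its
  tail if \<open>kind i = 1\<close>.
\<close>

definition encodes_graph :: "nat \<Rightarrow> nat set set \<Rightarrow> state \<Rightarrow> bool" where
  "encodes_graph n E s \<longleftrightarrow>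
     reg s ''n'' = n \<and> reg s ''m'' = card E \<and>
     arr s ''off'' 0 = 0 \<and>
     (\<forall>v<n. arr s ''off'' v \<le> arr s ''off'' (Suc v) \<and>
            bij_betw (arr s ''adj'') {arr s ''off'' v ..< arr s ''off'' (Suc v)} (neighbours E v))"

definition encodes_model ::
    "nat \<Rightarrow> (nat \<Rightarrow> complex) \<Rightarrow> (nat \<Rightarrow> complex) \<Rightarrow> state \<Rightarrow> bool" where
  "encodes_model n h t s \<longleftrightarrow>
     bij_betw (\<lambda>i. (arr s ''own'' i, arr s ''kind'' i)) {..<2 * n} ({..<n} \<times> {0, 1}) \<and>
     (let pt = (\<lambda>i. if arr s ''kind'' i = 0 then h (arr s ''own'' i) else t (arr s ''own'' i))
      in \<forall>i j. i < j \<and> j < 2 * n \<longrightarrow> Arg2pi (pt i / pt 0) < Arg2pi (pt j / pt 0))"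

definition input_state ::
    "nat \<Rightarrow> nat set set \<Rightarrow> (nat \<Rightarrow> complex) \<Rightarrow> (nat \<Rightarrow> complex) \<Rightarrow> state \<Rightarrow> bool" where
  "input_state n E h t s \<longleftrightarrow>
     encodes_graph n E s \<and> encodes_model n h t s \<and>
     (\<forall>x. x \<notin> {''n'', ''m''} \<longrightarrow> reg s x = 0) \<and>
     (\<forall>a i. a \<notin> {''off'', ''adj'', ''own'', ''kind''} \<longrightarrow> arr s a i = 0)"

text \<open>The answer is found in register \<open>ans\<close>; a tree is returned as the list of its \<open>n - 1\<close> edges, the
  \<open>i\<close>-th edge having the ends \<open>src i\<close> and \<open>dst i\<close>.\<close>

definition output_edges :: "nat \<Rightarrow> state \<Rightarrow> nat set set" where
  "output_edges n s = {{arr s ''src'' i, arr s ''dst'' i} | i. i < n - 1}"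

end

theory Submission
  imports Defs
begin

text \<open>
  Number the arcs cyclically in the order of their heads and let \<open>R i\<close> be the last index whose head
  lies in arc \<open>i\<close>. Call arc \<open>i\<close> sole if it alone covers the point just before the next head,
  that is \<open>R (i - 1) = i\<close>. If all sole arcs are among two consecutive ones, then the Hamiltonian path
  through the arcs in cyclic order, cut between those two, is locally connected, since the neighbours
  \<open>i - 1\<close>, \<open>i + 1\<close> of each inner vertex overlap. Otherwise two non-consecutive sole arcs separate
  the graph; in a locally connected spanning tree the two vertices of a separator are joined by a tree
  edge and have a common neighbour on each side. This yields three arcs \<open>a\<close>, \<open>b = R a\<close>,
  \<open>c \<le> R b\<close> that cover the circle, and conversely such a triple gives a locally connected
  spanning tree in which every vertex is adjacent to \<open>a\<close> or \<open>c\<close>. Both patterns are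
  found by a linear scan of \<open>R\<close>.
\<close>

section \<open>Connectedness and trees\<close>

lemma connected_graph_singleton: "connected_graph {x} E"
  by (simp add: connected_graph_def)

lemma connected_graph_star:
  assumes "z \<in> S" "\<And>x. x \<in> S \<Longrightarrow> x \<noteq> z \<Longrightarrow> {x, z} \<in> E"
  shows "connected_graph S E"
proof -
  let ?r = "{(x, y). x \<in> S \<and> y \<in> S \<and> {x, y} \<in> E}"
  have "(x, z) \<in> ?r\<^sup>* \<and> (z, x) \<in> ?r\<^sup>*" if "x \<in> S" for x
    using assms that by (cases "x = z") (auto simp: insert_commute)
  then show ?thesis
    using assms(1) unfolding connected_graph_def by (blast intro: rtrancl_trans)
qed

lemma connected_graph_Un:
  assumes S: "connected_graph S E" and S': "connected_graph S' E"
    and xy: "x \<in> S" "y \<in> S'" "{x, y} \<in> E"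
  shows "connected_graph (S \<union> S') E"
proof -
  let ?r = "\<lambda>S. {(x, y). x \<in> S \<and> y \<in> S \<and> {x, y} \<in> E}"
  have sub: "(?r S)\<^sup>* \<subseteq> (?r (S \<union> S'))\<^sup>*" "(?r S')\<^sup>* \<subseteq> (?r (S \<union> S'))\<^sup>*"
    by (auto intro!: rtrancl_mono)
  have e: "(x, y) \<in> (?r (S \<union> S'))\<^sup>*" "(y, x) \<in> (?r (S \<union> S'))\<^sup>*"
    using xy by (auto simp: insert_commute)
  have "(u, x) \<in> (?r (S \<union> S'))\<^sup>* \<and> (x, u) \<in> (?r (S \<union> S'))\<^sup>*" if "u \<in> S \<union> S'" for u
  proof (cases "u \<in> S")
    case True
    then have "(u, x) \<in> (?r S)\<^sup>*" "(x, u) \<in> (?r S)\<^sup>*"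
      using S xy(1) unfolding connected_graph_def by blast+
    then show ?thesis using sub(1) by blast
  next
    case False
    then have "(u, y) \<in> (?r S')\<^sup>*" "(y, u) \<in> (?r S')\<^sup>*"
      using that S' xy(2) unfolding connected_graph_def by blast+
    then have "(u, y) \<in> (?r (S \<union> S'))\<^sup>*" "(y, u) \<in> (?r (S \<union> S'))\<^sup>*"
      using sub(2) by blast+
    then show ?thesis using e by (meson rtrancl_trans)
  qed
  then show ?thesis
    using xy(1) unfolding connected_graph_def by (blast intro: rtrancl_trans)
qed

text \<open>Otherwise no walk inside \<open>S\<close> that starts in \<open>A\<close> could ever
  reach a vertex of \<open>S - A\<close>.\<close>

lemma connected_graph_leaves:
  assumes "connected_graph S E" "A \<subseteq> S" "A \<noteq> {}" "A \<noteq> S"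
  obtains u w where "u \<in> A" "w \<in> S - A" "{u, w} \<in> E"
proof -
  let ?r = "{(x, y). x \<in> S \<and> y \<in> S \<and> {x, y} \<in> E}"
  obtain a b where ab: "a \<in> A" "b \<in> S" "b \<notin> A" using assms by blast
  then have "(a, b) \<in> ?r\<^sup>*" using assms unfolding connected_graph_def by blast
  then have "b \<in> A \<or> (\<exists>u\<in>A. \<exists>w\<in>S - A. {u, w} \<in> E)"
    by (induction rule: rtrancl_induct) (use ab in auto)
  then show ?thesis using ab that by blast
qed

lemma cycle_in_triangle:
  assumes "distinct [x, y, z]" "{x, y} \<in> T" "{y, z} \<in> T" "{x, z} \<in> T"
  shows "cycle_in T [x, y, z]"
proof -
  have "{[x, y, z] ! i, [x, y, z] ! (Suc i mod 3)} \<in> T" if "i < 3" for i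
  proof -
    from that consider "i = 0" | "i = 1" | "i = 2" by linarith
    then show ?thesis using assms by cases (simp_all add: insert_commute)
  qed
  then show ?thesis using assms(1) by (simp add: cycle_in_def)
qed

text \<open>Trees are given by a parent map on indices. As \<open>rank\<close> drops along
  \<open>par\<close>, every parent chain ends at \<open>r\<close>, which gives connectedness; the
  same strict drop excludes cycles.\<close>

lemma parent_map_tree:
  fixes rank :: "'i \<Rightarrow> nat"
  assumes inj: "inj_on f J" and r: "r \<in> J"
    and par: "\<And>j. j \<in> J \<Longrightarrow> j \<noteq> r \<Longrightarrow> par j \<in> J \<and> rank (par j) < rank j"
  shows "tree_graph (f ` J) {{f (par j), f j} | j. j \<in> J \<and> j \<noteq> r}" (is "tree_graph _ ?T")
proof -
  let ?r = "{(x, y). x \<in> f ` J \<and> y \<in> f ` J \<and> {x, y} \<in> ?T}"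
  have "(f j, f r) \<in> ?r\<^sup>* \<and> (f r, f j) \<in> ?r\<^sup>*" if "j \<in> J" for j
    using that
  proof (induction "rank j" arbitrary: j rule: less_induct)
    case less
    show ?case
    proof (cases "j = r")
      case False
      then have p: "par j \<in> J" "rank (par j) < rank j" using par less.prems by auto
      have "{f (par j), f j} \<in> ?T" using less.prems False by blast
      then have "(f j, f (par j)) \<in> ?r" "(f (par j), f j) \<in> ?r"
        using p less.prems by (auto simp: insert_commute)
      then show ?thesis using less.hyps[OF p(2,1)]
        by (meson converse_rtrancl_into_rtrancl rtrancl.rtrancl_into_rtrancl)
    qed simp
  qed
  then have "connected_graph (f ` J) ?T"
    using r unfolding connected_graph_def by (blast intro: rtrancl_trans)
  moreover have False if "cycle_in ?T vs" for vs
  proof -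
    let ?n = "length vs"
    have vs: "3 \<le> ?n" "distinct vs" "\<And>i. i < ?n \<Longrightarrow> {vs ! i, vs ! (Suc i mod ?n)} \<in> ?T"
      using that by (auto simp: cycle_in_def)
    define k where "k = (\<lambda>v. rank (the_inv_into J f v))"
    have kf: "k (f j) = rank j" if "j \<in> J" for j
      using that inj by (simp add: k_def the_inv_into_f_f)
    \<comment> \<open>At a vertex of maximal rank both edges of the cycle lead to its parent.\<close>
    obtain m where m: "m < ?n" "\<And>i. i < ?n \<Longrightarrow> k (vs ! i) \<le> k (vs ! m)"
    proof -
      let ?K = "(\<lambda>i. k (vs ! i)) ` {..<?n}"
      have K: "finite ?K" "?K \<noteq> {}" using vs(1) by (auto simp: lessThan_empty_iff)
      obtain m where "Max ?K = k (vs ! m)" "m \<in> {..<?n}" using Max_in[OF K] by (rule imageE)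
      moreover have "k (vs ! i) \<le> Max ?K" if "i < ?n" for i using Max_ge[OF K(1)] that by simp
      ultimately show thesis using that by simp
    qed
    have up: "\<exists>j\<in>J. v = f j \<and> u = f (par j)"
      if hyp: "{u, v} \<in> ?T" "k u \<le> k v" for u v
    proof -
      obtain j where j: "j \<in> J" "j \<noteq> r" "{u, v} = {f (par j), f j}" using hyp(1) by blast
      have "k (f (par j)) < k (f j)" using par[OF j(1,2)] kf j(1) by simp
      then show ?thesis using j hyp(2) by (auto simp: doubleton_eq_iff)
    qed
    \<comment> \<open>Successor and predecessor of \<open>m\<close> on the cycle; adding
      \<open>?n\<close> first keeps the subtraction exact for \<open>m = 0\<close>. They differ
      because the cycle has at least three vertices.\<close>
    let ?s = "Suc m mod ?n" and ?p = "(m + ?n - 1) mod ?n"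
    have "0 < ?n" using vs(1) by linarith
    then have sp: "?s < ?n" "?p < ?n" by simp_all
    have "Suc ?p mod ?n = m"
    proof -
      have "Suc (m + ?n - 1) = m + ?n" using vs(1) by linarith
      then show ?thesis using m(1) by (simp add: mod_Suc_eq)
    qed
    then have "{vs ! ?p, vs ! m} \<in> ?T" using vs(3)[OF sp(2)] by simp
    moreover have "{vs ! ?s, vs ! m} \<in> ?T" using vs(3)[OF m(1)] by (simp add: insert_commute)
    ultimately obtain i j where "i \<in> J" "vs ! m = f i" "vs ! ?p = f (par i)"
      "j \<in> J" "vs ! m = f j" "vs ! ?s = f (par j)"
      using up[OF _ m(2)[OF sp(1)]] up[OF _ m(2)[OF sp(2)]] by blast
    then have "vs ! ?p = vs ! ?s" using inj_onD[OF inj, of i j] by simp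
    then have "?p = ?s" using vs(2) sp by (simp add: nth_eq_iff_index_eq)
    moreover have "?p \<noteq> ?s"
    proof (cases "m = 0")
      case False
      then have "m + ?n - 1 = (m - 1) + ?n" by simp
      then have "?p = m - 1" using m(1) by (metis less_imp_diff_less mod_add_self2 mod_less)
      moreover have "?s = (if Suc m = ?n then 0 else Suc m)" using m(1) by auto
      ultimately show ?thesis using False vs(1) by auto
    qed (use vs(1) in auto)
    ultimately show False by simp
  qed
  ultimately show ?thesis by (auto simp: tree_graph_def)
qed

text \<open>If x has tree neighbours on both sides of the separator, connectedness of its
  tree neighbourhood forces y into it; if neither x nor y has, one side is cut off in the tree.\<close>

lemma locally_connected_spanning_tree_separator:
  assumes T: "locally_connected_spanning_tree V E T"
    and V: "V = insert x (insert y (A \<union> B))"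
    and disj: "x \<notin> A \<union> B" "y \<notin> A \<union> B" "x \<noteq> y" "A \<inter> B = {}"
    and ne: "A \<noteq> {}" "B \<noteq> {}"
    and E: "\<And>u v. {u, v} \<in> E \<Longrightarrow> u \<in> V \<and> u \<noteq> v"
    and AB: "\<And>u v. u \<in> A \<Longrightarrow> v \<in> B \<Longrightarrow> {u, v} \<notin> E"
  shows "{x, y} \<in> T" and "\<exists>w\<in>A. {w, x} \<in> E \<and> {w, y} \<in> E"
proof -
  have con: "connected_graph V T" and TE: "T \<subseteq> E"
    and loc: "\<And>v. v \<in> V \<Longrightarrow> connected_graph (neighbours T v) E"
    using T by (auto simp: locally_connected_spanning_tree_def spanning_tree_def tree_graph_def)
  \<comment> \<open>The tree neighbourhood of \<open>z\<close> meets \<open>A\<close> and its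
    complement, so some edge of \<open>E\<close> leaves \<open>A\<close> inside it. By
    \<open>AB\<close> this edge does not end in \<open>B\<close>, hence it ends at the other
    separator vertex \<open>z'\<close>.\<close>
  have side: "\<exists>w\<in>A. {w, z} \<in> T \<and> {w, z'} \<in> E \<and> {z', z} \<in> T"
    if z: "{z, z'} = {x, y}" and a: "a \<in> A" "{a, z} \<in> T"
      and b: "b \<notin> A" "{b, z} \<in> T" for z z' a b
  proof -
    have "z \<in> V" using z V by (auto simp: doubleton_eq_iff)
    have "A \<inter> neighbours T z \<noteq> {}" "A \<inter> neighbours T z \<noteq> neighbours T z"
      using a b by (auto simp: neighbours_def)
    then obtain u w where "u \<in> A \<inter> neighbours T z" "w \<in> neighbours T z - A \<inter> neighbours T z"
      "{u, w} \<in> E"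
      by (rule connected_graph_leaves[OF loc[OF \<open>z \<in> V\<close>] Int_lower2])
    then have uw: "u \<in> A" "{u, z} \<in> T" "w \<notin> A" "{w, z} \<in> T" "{u, w} \<in> E"
      by (auto simp: neighbours_def)
    then have "w \<in> V" "w \<noteq> z" "w \<notin> B" using E AB TE by (blast, blast, blast)
    then have "w = z'" using V z uw(3) by (auto simp: doubleton_eq_iff)
    then show ?thesis using uw by blast
  qed
  have A: "A \<subseteq> V" "A \<noteq> V" using V disj by auto
  obtain a z where az: "a \<in> A" "z \<in> V - A" "{a, z} \<in> T"
    by (rule connected_graph_leaves[OF con A(1) ne(1) A(2)])
  have "z \<notin> B" using AB az TE by blast
  then obtain z' where z': "{z, z'} = {x, y}" using az V by auto
  show xy: "{x, y} \<in> T"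
  proof (rule ccontr)
    assume no: "{x, y} \<notin> T"
    have nb: "b \<in> A" if hyp: "{b, u} \<in> T" "{c, u} \<in> T" "c \<in> A" "u = x \<or> u = y" for b c u
    proof (rule ccontr)
      assume "b \<notin> A"
      moreover obtain u' where "{u, u'} = {x, y}" using hyp(4) by auto
      ultimately have "{u', u} \<in> T" using side[of u u' c b] hyp by blast
      then show False using no \<open>{u, u'} = {x, y}\<close> by (simp add: insert_commute)
    qed
    \<comment> \<open>By \<open>nb\<close> a separator vertex with a tree neighbour in
      \<open>A\<close> has all its tree neighbours in \<open>A\<close>. So no tree edge leaves this
      set; as it misses \<open>B\<close>, the tree would be disconnected.\<close>
    let ?S = "A \<union> {u \<in> {x, y}. \<exists>c\<in>A. {c, u} \<in> T}"
    have "?S \<subseteq> V" "?S \<noteq> {}" "?S \<noteq> V" using V ne disj by auto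
    then obtain u w where uw: "u \<in> ?S" "w \<in> V - ?S" "{u, w} \<in> T"
      by (rule connected_graph_leaves[OF con])
    show False
    proof (cases "u \<in> A")
      case True
      then have "w \<notin> B" using AB uw TE by blast
      then show False using uw True V by auto
    next
      case False
      then obtain c where "c \<in> A" "{c, u} \<in> T" "u = x \<or> u = y" using uw by auto
      moreover have "{w, u} \<in> T" using uw(3) by (simp add: insert_commute)
      ultimately have "w \<in> A" using nb by blast
      then show False using uw by blast
    qed
  qed
  have "z' \<notin> A" "{z', z} \<in> T" using z' xy disj by (auto simp: doubleton_eq_iff insert_commute)
  then obtain w where "w \<in> A" "{w, z} \<in> T" "{w, z'} \<in> E"
    using side[OF z' az(1,3)] by blast
  then show "\<exists>w\<in>A. {w, x} \<in> E \<and> {w, y} \<in> E"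
    using z' TE by (auto simp: doubleton_eq_iff)
qed

section \<open>Round enumerations\<close>

text \<open>The arcs are indexed cyclically, with period \<open>n\<close>, in the order of their heads; \<open>R i\<close> is the
  last index, counted from \<open>i\<close> onwards, whose head lies in the arc of \<open>i\<close>.\<close>

locale round_enumeration =
  fixes n :: nat and V :: "'a set" and E :: "'a set set" and ord :: "nat \<Rightarrow> 'a" and R :: "nat \<Rightarrow> nat"
  assumes n3: "3 \<le> n"
    and ord_onto: "ord ` {..<n} = V" and card_V: "card V = n"
    and ord_period: "ord (i + n) = ord i"
    and R_period: "R (i + n) = R i + n"
    and R_gt: "i < R i" and R_less: "R i < i + n"
    and R_Suc: "R i \<le> R (Suc i)"
    and adj: "i < j \<Longrightarrow> j < i + n \<Longrightarrow> {ord i, ord j} \<in> E \<longleftrightarrow> j \<le> R i \<or> i + n \<le> R j"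
    and E_V: "{u, v} \<in> E \<Longrightarrow> u \<in> V \<and> u \<noteq> v"
begin

lemma R_mono: "i \<le> j \<Longrightarrow> R i \<le> R j"
  using R_Suc by (rule lift_Suc_mono_le)

lemma adjI: "i < j \<Longrightarrow> j < i + n \<Longrightarrow> j \<le> R i \<Longrightarrow> {ord i, ord j} \<in> E"
  using adj by blast

text \<open>Moving the window by one exchanges \<open>a\<close> for \<open>a + n\<close>, which
  names the same vertex. Hence a tree may be laid out from any cut of the circle.\<close>

lemma ord_window: "ord ` {a..<a + n} = V"
proof (induction a)
  case 0
  show ?case using ord_onto by (simp add: atLeast0LessThan)
next
  case (Suc a)
  have "{Suc a..<Suc a + n} = insert (a + n) {Suc a..<a + n}" "{a..<a + n} = insert a {Suc a..<a + n}"
    using n3 by auto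
  then show ?case using Suc by (simp add: ord_period)
qed

lemma inj_on_ord: "inj_on ord {a..<a + n}"
  using ord_window card_V by (intro eq_card_imp_inj_on) auto

lemma ord_eq_iff: "a \<le> i \<Longrightarrow> i < a + n \<Longrightarrow> a \<le> j \<Longrightarrow> j < a + n \<Longrightarrow> ord i = ord j \<longleftrightarrow> i = j"
  using inj_on_eq_iff[OF inj_on_ord] by simp

section \<open>Two constructions of locally connected spanning trees: path and triangle\<close>

text \<open>The index set in \<open>loc\<close> is the tree neighbourhood of \<open>i\<close>,
  namely its parent (unless \<open>i\<close> is the root \<open>a\<close>) and its children. Local
  connectedness thus becomes a condition on indices.\<close>

lemma parent_map_lcst:
  fixes rank :: "nat \<Rightarrow> nat"
  assumes par: "\<And>j. a < j \<Longrightarrow> j < a + n \<Longrightarrow>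
      a \<le> par j \<and> par j < a + n \<and> rank (par j) < rank j \<and> {ord (par j), ord j} \<in> E"
    and loc: "\<And>i. a \<le> i \<Longrightarrow> i < a + n \<Longrightarrow>
      connected_graph (ord ` ((if i = a then {} else {par i}) \<union> {j. a < j \<and> j < a + n \<and> par j = i})) E"
  shows "locally_connected_spanning_tree V E {{ord (par j), ord j} | j. a < j \<and> j < a + n}"
    (is "locally_connected_spanning_tree V E ?T")
proof -
  have "{{ord (par j), ord j} | j. j \<in> {a..<a + n} \<and> j \<noteq> a} = ?T" by force
  moreover have "tree_graph (ord ` {a..<a + n}) {{ord (par j), ord j} | j. j \<in> {a..<a + n} \<and> j \<noteq> a}"
    using par n3 by (intro parent_map_tree[OF inj_on_ord, where rank = rank]) auto
  ultimately have "tree_graph V ?T" by (simp add: ord_window)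
  moreover have "neighbours ?T (ord i) = ord ` ((if i = a then {} else {par i}) \<union> {j. a < j \<and> j < a + n \<and> par j = i})"
    if i: "a \<le> i" "i < a + n" for i
  proof -
    have "ord i = ord (par j) \<longleftrightarrow> par j = i" "ord i = ord j \<longleftrightarrow> j = i" if "a < j" "j < a + n" for j
      using ord_eq_iff[of a] par[OF that] that i by auto
    then have "{u, ord i} = {ord (par j), ord j} \<longleftrightarrow> u = ord (par i) \<and> j = i \<or> u = ord j \<and> par j = i"
      if "a < j" "j < a + n" for u j
      using that unfolding doubleton_eq_iff by blast
    then have "neighbours ?T (ord i) =
        {u. \<exists>j. a < j \<and> j < a + n \<and> (u = ord (par i) \<and> j = i \<or> u = ord j \<and> par j = i)}"
      unfolding neighbours_def by blast
    also have "\<dots> = ord ` ((if i = a then {} else {par i}) \<union> {j. a < j \<and> j < a + n \<and> par j = i})"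
      using i(2) order_le_imp_less_or_eq[OF i(1)] by auto
    finally show ?thesis .
  qed
  ultimately show ?thesis
    using par loc ord_window[of a]
    unfolding locally_connected_spanning_tree_def spanning_tree_def by (fastforce simp: image_iff)
qed

text \<open>The two ends have a single tree neighbour. An inner vertex \<open>i\<close> has the
  neighbours \<open>i - 1\<close> and \<open>i + 1\<close>, which are adjacent once
  \<open>R (i - 1)\<close> exceeds \<open>i\<close>; so \<open>x = i - 1\<close> runs from
  \<open>s\<close> to \<open>s + n - 3\<close>.\<close>

lemma path_lcst:
  assumes "\<And>x. s \<le> x \<Longrightarrow> x + 2 < s + n \<Longrightarrow> R x \<noteq> Suc x"
  shows "locally_connected_spanning_tree V E {{ord (j - 1), ord j} | j. s < j \<and> j < s + n}"
proof (rule parent_map_lcst[where rank = "\<lambda>j. j"])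
  fix j assume "s < j" "j < s + n"
  moreover from this have "{ord (j - 1), ord j} \<in> E"
    using R_gt[of "j - 1"] n3 by (intro adjI) auto
  ultimately show "s \<le> j - 1 \<and> j - 1 < s + n \<and> j - 1 < j \<and> {ord (j - 1), ord j} \<in> E" by auto
next
  fix i assume i: "s \<le> i" "i < s + n"
  have S: "(if i = s then {} else {i - 1}) \<union> {j. s < j \<and> j < s + n \<and> j - 1 = i} =
      (if i = s then {Suc s} else if Suc i = s + n then {i - 1} else {i - 1, Suc i})"
    using i n3 by auto
  have "{ord (i - 1), ord (Suc i)} \<in> E" if "i \<noteq> s" "Suc i \<noteq> s + n"
  proof (rule adjI)
    have "R (i - 1) \<noteq> i" using assms[of "i - 1"] i that by simp
    then show "Suc i \<le> R (i - 1)" using R_gt[of "i - 1"] by linarith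
  qed (use n3 i that in auto)
  then show "connected_graph (ord ` ((if i = s then {} else {i - 1}) \<union> {j. s < j \<and> j < s + n \<and> j - 1 = i})) E"
    unfolding S by (auto intro!: connected_graph_singleton connected_graph_star[of "ord (Suc i)"])
qed

text \<open>Three arcs \<open>a < b < c\<close> that cover the circle; the last condition makes the tree neighbourhood
  of \<open>c\<close> connected in \<open>triangle_lcst\<close>.\<close>

definition triangle :: "nat \<Rightarrow> nat \<Rightarrow> nat \<Rightarrow> bool" where
  "triangle a b c \<longleftrightarrow> b = R a \<and> c = min (R b) (a + n - 1) \<and> b < c \<and> a + n \<le> R c \<and>
     (c = Suc b \<or> c < R (c - 1))"

lemma triangle_shift: "triangle (a + n) (b + n) (c + n) \<longleftrightarrow> triangle a b c"
\<comment> \<open>The case \<open>c = 0\<close> is split off because \<open>c - 1\<close> is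
  truncated there; both sides are then false.\<close>
proof (cases "c = 0")
  case False
  then have "R (c + n - 1) = R (c - 1) + n" using R_period[of "c - 1"] by (simp add: algebra_simps)
  moreover have "min (R b + n) (a + n + n - 1) = min (R b) (a + n - 1) + n" using n3 by auto
  ultimately show ?thesis unfolding triangle_def R_period by (auto simp: add.commute)
next
  case True
  then show ?thesis using R_gt[of a] R_gt[of "a+n"] unfolding triangle_def R_period by auto
qed

text \<open>The root \<open>a\<close> has the children up to \<open>b\<close> and the child
  \<open>c\<close>; all others hang from \<open>c\<close>. The neighbourhood of \<open>a\<close> is
  a star around \<open>b\<close>. That of \<open>c\<close> consists of a star around
  \<open>c - 1\<close> and a star around \<open>a\<close>, linked by the edge from
  \<open>c - 1\<close> to \<open>Suc c\<close>.\<close>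

lemma triangle_lcst:
  assumes "triangle a b c"
  shows "locally_connected_spanning_tree V E
    {{ord (if j \<le> b \<or> j = c then a else c), ord j} | j. a < j \<and> j < a + n}"
proof -
  define par where "par = (\<lambda>j. if j \<le> b \<or> j = c then a else c)"
  define rank :: "nat \<Rightarrow> nat" where "rank = (\<lambda>j. if j = a then 0 else if j \<le> b \<or> j = c then 1 else 2)"
  have b: "b = R a" "a < b" and c: "b < c" "c < a + n" "c \<le> R b" "a + n \<le> R c"
    and last: "c = Suc b \<or> c < R (c - 1)"
    using assms R_gt[of a] n3 by (auto simp: triangle_def)
  \<comment> \<open>Each stretch from \<open>a\<close> to \<open>b\<close>, from \<open>b\<close> to
    \<open>c\<close> and from \<open>c\<close> to \<open>a + n\<close> is a clique: the arc at its
    start reaches its end, and \<open>R\<close> is monotone.\<close>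
  have near: "{ord i, ord j} \<in> E" if "i < j" "a \<le> i" "j \<le> a + n" "i = a \<longrightarrow> j < a + n"
      "j \<le> b \<or> b \<le> i \<and> j \<le> c \<or> c \<le> i" for i j
  proof -
    have "j \<le> R i" using that b c R_mono[of a i] R_mono[of b i] R_mono[of c i] by auto
    then show ?thesis using that by (intro adjI) auto
  qed
  have near': "{ord j, ord i} \<in> E" if "i < j" "a \<le> i" "j \<le> a + n" "i = a \<longrightarrow> j < a + n"
      "j \<le> b \<or> b \<le> i \<and> j \<le> c \<or> c \<le> i" for i j
    using near[OF that] by (simp add: insert_commute)
  have an: "ord a = ord (a + n)" by (simp add: ord_period)
  have "locally_connected_spanning_tree V E {{ord (par j), ord j} | j. a < j \<and> j < a + n}"
  proof (rule parent_map_lcst[where rank = rank])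
    fix j assume j: "a < j" "j < a + n"
    have "{ord (par j), ord j} \<in> E"
    proof -
      consider "j \<le> b" | "j = c" | "b < j" "j < c" | "c < j" by linarith
      then show ?thesis
      proof cases
        case 1
        then show ?thesis using near[of a j] j by (simp add: par_def)
      next
        case 2
        then show ?thesis using near'[of c "a + n"] b c by (simp add: par_def an)
      next
        case 3
        then show ?thesis using near'[of j c] j b c by (simp add: par_def)
      next
        case 4
        then show ?thesis using near[of c j] j b c by (simp add: par_def)
      qed
    qed
    then show "a \<le> par j \<and> par j < a + n \<and> rank (par j) < rank j \<and> {ord (par j), ord j} \<in> E"
      using j b(2) c by (auto simp: par_def rank_def)
  next
    fix i assume i: "a \<le> i" "i < a + n"
    \<comment> \<open>Only \<open>a\<close> and \<open>c\<close> have children, so every other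
      vertex is a leaf and its neighbourhood is one parent.\<close>
    have S: "(if i = a then {} else {par i}) \<union> {j. a < j \<and> j < a + n \<and> par j = i} =
      (if i = a then {a<..b} \<union> {c} else if i = c then {b<..<c} \<union> insert a {c<..<a + n} else {par i})"
      using i b(2) c by (auto simp: par_def)
    have "connected_graph (ord ` ({a<..b} \<union> {c})) E"
    proof (rule connected_graph_star)
      show "ord b \<in> ord ` ({a<..b} \<union> {c})" using b(2) by simp
    next
      fix x assume "x \<in> ord ` ({a<..b} \<union> {c})" "x \<noteq> ord b"
      then obtain j where "x = ord j" "a < j \<and> j < b \<or> j = c"
        by (auto simp: order.order_iff_strict)
      then show "{x, ord b} \<in> E" using near[of j b] near'[of b c] b(2) c by auto
    qed
    moreover have "connected_graph (ord ` ({b<..<c} \<union> insert a {c<..<a + n})) E"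
    proof -
      let ?S = "insert a {c<..<a + n}"
      have S: "connected_graph (ord ` ?S) E"
      proof (rule connected_graph_star)
        fix x assume "x \<in> ord ` ?S" "x \<noteq> ord a"
        then obtain j where "x = ord j" "c < j" "j < a + n" by force
        then show "{x, ord a} \<in> E" using near[of j "a + n"] b(2) c by (simp add: an)
      qed simp
      show ?thesis
      proof (cases "c = Suc b")
        case True
        then have "{b<..<c} = {}" by auto
        then show ?thesis using S by simp
      next
        case False
        have c1: "ord (c - 1) \<in> ord ` {b<..<c}" using False c by auto
        then have "connected_graph (ord ` {b<..<c}) E"
        proof (rule connected_graph_star)
          fix x assume "x \<in> ord ` {b<..<c}" "x \<noteq> ord (c - 1)"
          then obtain j where "x = ord j" "b < j" "j < c" "j \<noteq> c - 1" by force
          then show "{x, ord (c - 1)} \<in> E" using near[of j "c - 1"] b(2) c by simp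
        qed
        \<comment> \<open>If \<open>c\<close> is the last index of the window, its successor
          \<open>a + n\<close> is the root again.\<close>
        moreover have "ord (Suc c) \<in> ord ` ?S"
          using c by (cases "Suc c = a + n") (auto simp: an)
        moreover have "{ord (c - 1), ord (Suc c)} \<in> E"
          using False last c b n3 by (intro adjI) auto
        ultimately show ?thesis using connected_graph_Un[OF _ S c1] by (metis image_Un)
      qed
    qed
    ultimately show "connected_graph (ord ` ((if i = a then {} else {par i}) \<union>
        {j. a < j \<and> j < a + n \<and> par j = i})) E"
      unfolding S by (auto intro: connected_graph_singleton)
  qed
  then show ?thesis by (simp add: par_def)
qed

section \<open>Necessity: sole arcs as separators\<close>

text \<open>Only the arc of \<open>i\<close> covers the point just before the head of its successor.\<close>

definition sole :: "nat \<Rightarrow> bool" where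
  "sole i \<longleftrightarrow> R (i + n - 1) = i + n"

lemma sole_period: "sole (i + n) \<longleftrightarrow> sole i"
  using R_period[of "i + n - 1"] n3 by (simp add: sole_def)

text \<open>The shift by \<open>n\<close> in \<open>sole\<close> serves the index \<open>0\<close>,
  which has no predecessor; at a successor it cancels by periodicity.\<close>

lemma sole_Suc: "sole (Suc i) \<longleftrightarrow> R i = Suc i"
  using R_period[of i] by (simp add: sole_def)

text \<open>By monotonicity it suffices that \<open>i - 1\<close> reaches only up to
  \<open>i\<close>. That no earlier arc passes a sole one is what makes pairs of sole arcs
  separators.\<close>

lemma sole_R: "sole i \<Longrightarrow> j < i \<Longrightarrow> R j \<le> i"
  using R_mono[of j "i - 1"] sole_Suc[of "i - 1"] by auto

text \<open>Arcs strictly between \<open>a\<close> and \<open>b\<close> reach at most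
  \<open>b\<close>, those strictly between \<open>b\<close> and \<open>a + n\<close> at most
  \<open>a + n\<close>, so no edge joins the two stretches. The last conclusion is the common
  neighbour on the side after \<open>b\<close>, expressed in indices.\<close>

lemma sole_separator:
  assumes T: "locally_connected_spanning_tree V E T"
    and ab: "Suc a < b" "Suc b < a + n" and sole: "sole a" "sole b"
  shows "{ord a, ord b} \<in> T" and "b \<le> R a \<or> a + n \<le> R b"
    and "\<exists>w. b < w \<and> w < a + n \<and> w \<le> R b \<and> a + n \<le> R w"
proof -
  let ?A = "{a<..<b}" and ?B = "{b<..<a + n}"
  have sole': "sole (a + n)" using sole by (simp add: sole_period)
  have "{a..<a + n} = insert a (insert b (?B \<union> ?A))" using ab by auto
  then have V: "V = insert (ord a) (insert (ord b) (ord ` ?B \<union> ord ` ?A))"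
    using ord_window[of a] by (metis image_Un image_insert)
  have disj: "ord a \<notin> ord ` ?B \<union> ord ` ?A" "ord b \<notin> ord ` ?B \<union> ord ` ?A" "ord a \<noteq> ord b"
    "ord ` ?B \<inter> ord ` ?A = {}"
    using ab by (auto simp: ord_eq_iff[of a])
  have ne: "ord ` ?B \<noteq> {}" "ord ` ?A \<noteq> {}" using ab by auto
  have AB: "{u, v} \<notin> E" if "u \<in> ord ` ?B" "v \<in> ord ` ?A" for u v
  proof -
    from that obtain i j where ij: "u = ord j" "v = ord i" "i \<in> ?A" "j \<in> ?B" by blast
    have "R i \<le> b" "R j \<le> a + n" using sole_R[OF sole(2)] sole_R[OF sole'] ij by auto
    then have "{ord i, ord j} \<notin> E" using ij by (subst adj) auto
    then show ?thesis using ij by (simp add: insert_commute)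
  qed
  \<comment> \<open>The stretch after \<open>b\<close> plays the part of \<open>A\<close>, so that
    the common neighbour is found there.\<close>
  note sep = locally_connected_spanning_tree_separator[OF T V disj ne E_V AB]
  show "{ord a, ord b} \<in> T" by (rule sep(1))
  then have "{ord a, ord b} \<in> E"
    using T by (auto simp: locally_connected_spanning_tree_def spanning_tree_def)
  then show "b \<le> R a \<or> a + n \<le> R b" using ab adj by auto
  obtain w where w: "w \<in> ?B" "{ord w, ord a} \<in> E" "{ord w, ord b} \<in> E" using sep(2) by auto
  have "w \<le> R a \<or> a + n \<le> R w" "w \<le> R b \<or> b + n \<le> R w"
    using w ab adj[of a w] adj[of b w] by (auto simp: insert_commute)
  \<comment> \<open>Soleness of \<open>b\<close> excludes \<open>w \<le> R a\<close> and soleness of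
    \<open>a\<close> excludes \<open>b + n \<le> R w\<close>, which leaves the two wanted
    bounds.\<close>
  moreover have "R a \<le> b" "R w \<le> a + n" using sole_R[OF sole(2)] sole_R[OF sole'] ab w by auto
  ultimately show "\<exists>w. b < w \<and> w < a + n \<and> w \<le> R b \<and> a + n \<le> R w" using w ab by auto
qed

text \<open>Here \<open>R a = b\<close>, and the common neighbour \<open>w\<close> of
  \<open>a\<close> and \<open>b\<close> is at most \<open>c\<close>, so \<open>c\<close> reaches
  \<open>a + n\<close>. If the last condition of \<open>triangle\<close> fails, \<open>c\<close> is
  sole too; acyclicity then makes \<open>c\<close> the predecessor of \<open>a + n\<close>, and
  \<open>b\<close>, \<open>c\<close>, \<open>a + n\<close> form a triangle instead.\<close>

lemma triangle_of_soles:
  assumes T: "locally_connected_spanning_tree V E T"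
    and ab: "Suc a < b" "Suc b < a + n" and sole: "sole a" "sole b" and Ra: "b \<le> R a"
  shows "\<exists>a b c. triangle a b c"
proof -
  define c where "c = min (R b) (a + n - 1)"
  have Rab: "R a = b" using sole_R[OF sole(2), of a] Ra ab by simp
  obtain w where w: "b < w" "w < a + n" "w \<le> R b" "a + n \<le> R w"
    using sole_separator(3)[OF T ab sole] by blast
  then have c: "b < c" "c < a + n" "a + n \<le> R c" using R_mono[of w c] n3 unfolding c_def by linarith+
  show ?thesis
  proof (cases "c = Suc b \<or> c < R (c - 1)")
    case True
    then have "triangle a b c" using c Rab by (auto simp: triangle_def c_def)
    then show ?thesis by blast
  next
    case False
    then have sc: "sole c" using sole_Suc[of "c - 1"] R_gt[of "c - 1"] c by auto
    have bc: "Suc b < c" "Suc c < b + n" using False c ab by auto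
    have "{ord b, ord c} \<in> T" by (rule sole_separator(1)[OF T bc sole(2) sc])
    moreover have "{ord a, ord b} \<in> T" by (rule sole_separator(1)[OF T ab sole])
    moreover have "\<not> cycle_in T [ord a, ord b, ord c]"
      using T by (simp add: locally_connected_spanning_tree_def spanning_tree_def tree_graph_def)
    moreover have "distinct [ord a, ord b, ord c]"
      using ab c by (auto simp: ord_eq_iff[of a])
    ultimately have "{ord a, ord c} \<notin> T" using cycle_in_triangle by metis
    then have "\<not> Suc c < a + n"
      using sole_separator(1)[OF T _ _ sole(1) sc] ab bc by auto
    then have ca: "Suc c = a + n" using c by simp
    have "R c = Suc c" using ca sole(1) by (auto simp: sole_def simp flip: ca)
    moreover have "R b = c" using sole_R[OF sc, of b] c by (simp add: c_def)
    moreover have "R (Suc c) = b + n" using ca Rab R_period by simp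
    ultimately have "triangle b c (Suc c)" using bc by (auto simp: triangle_def)
    then show ?thesis by blast
  qed
qed

lemma triangle_reduce:
  assumes "triangle a b c"
  shows "\<exists>a<n. \<exists>b c. triangle a b c"
  using assms
proof (induction a arbitrary: b c rule: less_induct)
  case (less a)
  show ?case
  proof (cases "a < n")
    case False
    then have "n \<le> b" "n \<le> c" using less.prems R_gt[of a] by (auto simp: triangle_def)
    then have "triangle (a - n) (b - n) (c - n)"
      using triangle_shift[of "a - n" "b - n" "c - n"] less.prems False by simp
    then show ?thesis using less.IH[of "a - n"] False n3 by auto
  qed (use less.prems in blast)
qed

text \<open>Without a triangle no two sole arcs are non-consecutive, so at most two consecutive arcs
  are sole, and the path is cut so that they become its ends.\<close>

theorem lcst_path_or_triangle:
  assumes T: "locally_connected_spanning_tree V E T"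
  shows "(\<exists>s<n. \<forall>x. s \<le> x \<and> x + 2 < s + n \<longrightarrow> R x \<noteq> Suc x) \<or> (\<exists>a<n. \<exists>b c. triangle a b c)"
proof (rule disjCI)
  assume no_tri: "\<nexists>a. a < n \<and> (\<exists>b c. triangle a b c)"
  then have no_tri: "\<not> triangle a b c" for a b c using triangle_reduce by blast
  \<comment> \<open>Of the two ways in which \<open>x\<close> and \<open>y\<close> can be adjacent,
    one gives a triangle from the pair \<open>x\<close>, \<open>y\<close> and the other from the
    pair \<open>y\<close>, \<open>x + n\<close>.\<close>
  have far: False if xy: "Suc x < y" "Suc y < x + n" "sole x" "sole y" for x y
  proof -
    have "x + n \<le> R y" using triangle_of_soles[OF T xy] no_tri sole_separator(2)[OF T xy] by blast
    then show False
      using triangle_of_soles[OF T xy(2) _ xy(4), of] xy no_tri by (simp add: sole_period)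
  qed
  show "\<exists>s<n. \<forall>x. s \<le> x \<and> x + 2 < s + n \<longrightarrow> R x \<noteq> Suc x"
  proof (cases "\<exists>i<n. sole i")
    case False
    have "\<not> sole i" for i
    proof (induction i rule: less_induct)
      case (less i)
      then show ?case using False sole_period[of "i - n"] n3 by (cases "i < n") auto
    qed
    then show ?thesis using sole_Suc n3 by (intro exI[of _ 0]) auto
  next
    case True
    then obtain i where i: "i < n" "sole i" by blast
    have i': "sole (i + n)" using i by (simp add: sole_period)
    have mid: "\<not> sole j" if "Suc i < j" "Suc j < i + n" for j using far[OF that i(2)] by blast
    show ?thesis
    proof (cases "sole (Suc i)")
      case False
      have "R x \<noteq> Suc x" if "i \<le> x \<and> x + 2 < i + n" for x
        using mid[of "Suc x"] False that unfolding sole_Suc by (cases "x = i") auto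
      then show ?thesis using i by blast
    next
      case True
      \<comment> \<open>Three consecutive sole arcs are impossible: for \<open>n > 3\<close> the
        outer two are non-consecutive, and for \<open>n = 3\<close> the three form a
        triangle.\<close>
      have "\<not> sole (i + n - 1)"
      proof
        assume s: "sole (i + n - 1)"
        show False
        proof (cases "n = 3")
          case False
          then have "Suc (Suc i) < i + n - 1" "Suc (i + n - 1) < Suc i + n" using n3 by linarith+
          then show False using far[OF _ _ True s] by blast
        next
          case True
          then have "R i = Suc i" "R (Suc i) = Suc (Suc i)" "R (Suc (Suc i)) = i + n"
            using s i i' \<open>sole (Suc i)\<close> sole_Suc[of i] sole_Suc[of "Suc i"] sole_Suc[of "Suc (Suc i)"]
            by (auto simp: numeral_3_eq_3)
          then have "triangle i (Suc i) (Suc (Suc i))" unfolding triangle_def using True by auto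
          then show False using no_tri by blast
        qed
      qed
      then have last: "R x \<noteq> Suc x" if "Suc (Suc x) = i + n" for x
        using that sole_Suc[of x] by (metis diff_Suc_1)
      have nb: "R x \<noteq> Suc x" if "Suc i \<le> x \<and> x + 2 < Suc i + n" for x
        using mid[of "Suc x"] last[of x] that unfolding sole_Suc by (cases "Suc (Suc x) = i + n") auto
      show ?thesis
      \<comment> \<open>The start has to lie in the first period; if \<open>Suc i = n\<close>,
        shifting back by \<open>n\<close> gives the start \<open>0\<close>.\<close>
      proof (cases "Suc i < n")
        case False
        then have "R x \<noteq> Suc x" if "x + 2 < n" for x
          using nb[of "x + n"] i that R_period[of x] by auto
        then show ?thesis using n3 by (intro exI[of _ 0]) auto
      qed (use nb in blast)
    qed
  qed
qed

end

section \<open>Arcs of the circle\<close>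

text \<open>As \<open>z / p\<close> is the quotient of \<open>z / b\<close> by \<open>p / b\<close>,
  angles seen from any point are differences, modulo a full turn, of angles seen from one base. Arc
  membership thereby becomes linear arithmetic.\<close>

lemma Arg2pi_divide_base:
  assumes "z \<noteq> 0" "p \<noteq> 0" "b \<noteq> 0"
  shows "Arg2pi (z / p) = (if Arg2pi (p / b) \<le> Arg2pi (z / b) then Arg2pi (z / b) - Arg2pi (p / b)
    else Arg2pi (z / b) - Arg2pi (p / b) + 2 * pi)"
  using Arg2pi_diff[of "z / b" "p / b"] assms by auto

lemma head_in_ccw_arc: "h \<in> sphere 0 1 \<Longrightarrow> h \<in> ccw_arc h t"
proof -
  assume h: "h \<in> sphere 0 1"
  then have "h / h = 1" by auto
  moreover have "Arg2pi 1 = 0" using Arg2pi_of_real[of 1] by simp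
  ultimately show ?thesis using h Arg2pi_ge_0 by (simp add: ccw_arc_def)
qed

text \<open>Walking clockwise from a common point, the first head that is met lies in the other
  arc.\<close>

lemma ccw_arcs_meet_iff:
  assumes "h \<in> sphere 0 1" "h' \<in> sphere 0 1"
  shows "ccw_arc h t \<inter> ccw_arc h' t' \<noteq> {} \<longleftrightarrow> h' \<in> ccw_arc h t \<or> h \<in> ccw_arc h' t'"
proof
  assume "ccw_arc h t \<inter> ccw_arc h' t' \<noteq> {}"
  then obtain z where z: "z \<in> sphere 0 1" "Arg2pi (z / h) \<le> Arg2pi (t / h)"
    "Arg2pi (z / h') \<le> Arg2pi (t' / h')"
    by (auto simp: ccw_arc_def)
  have nz: "z \<noteq> 0" "h \<noteq> 0" "h' \<noteq> 0" using z assms by auto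
  have hh: "Arg2pi (h / h) = 0" using Arg2pi_of_real[of 1] nz by simp
  show "h' \<in> ccw_arc h t \<or> h \<in> ccw_arc h' t'"
  proof (cases "Arg2pi (h' / h) \<le> Arg2pi (z / h)")
    case True
    then show ?thesis using z assms by (auto simp: ccw_arc_def)
  next
    case False
    then have "Arg2pi (h / h') \<le> Arg2pi (z / h')"
      using Arg2pi_divide_base[OF nz(1,3,2)] Arg2pi_divide_base[OF nz(2,3,2)] hh
        Arg2pi_ge_0[of "z / h"] by auto
    then show ?thesis using z assms by (auto simp: ccw_arc_def)
  qed
qed (use assms head_in_ccw_arc in blast)

text \<open>Seen from \<open>h\<close>, the head \<open>h'\<close> does not come after
  \<open>w\<close>, and the second arc stops before \<open>w\<close>; so it stays in the stretch
  from \<open>h\<close> to \<open>w\<close>, which belongs to the first arc.\<close>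

lemma ccw_arc_subset:
  assumes "h \<in> sphere 0 1" "h' \<in> sphere 0 1" "w \<in> sphere 0 1"
    and w: "w \<in> ccw_arc h t" "w \<notin> ccw_arc h' t'" "Arg2pi (h' / h) \<le> Arg2pi (w / h)"
  shows "ccw_arc h' t' \<subseteq> ccw_arc h t"
proof
  fix z assume z: "z \<in> ccw_arc h' t'"
  then have nz: "z \<noteq> 0" "h \<noteq> 0" "h' \<noteq> 0" "w \<noteq> 0" using assms by (auto simp: ccw_arc_def)
  have "Arg2pi (z / h') < Arg2pi (w / h')" using z w(2) assms(3) by (auto simp: ccw_arc_def)
  then have "Arg2pi (z / h) \<le> Arg2pi (w / h)"
    using Arg2pi_divide_base[OF nz(1,3,2)] Arg2pi_divide_base[OF nz(4,3,2)] w(3)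
      Arg2pi_ge_0[of "z / h"] Arg2pi_lt_2pi[of "w / h"] by (auto split: if_splits)
  then show "z \<in> ccw_arc h t" using z w(1) by (auto simp: ccw_arc_def)
qed

section \<open>The round enumeration of a proper model\<close>

locale endpoint_sequence =
  fixes n :: nat and E :: "nat set set" and h t :: "nat \<Rightarrow> complex" and own kind :: "nat \<Rightarrow> nat"
  assumes n3: "3 \<le> n" and proper: "proper_model {..<n} E h t"
    and dense: "v < n \<Longrightarrow> 2 \<le> density {..<n} h t v"
    and bij: "bij_betw (\<lambda>i. (own i, kind i)) {..<2 * n} ({..<n} \<times> {0, 1})"
    and sorted: "i < j \<Longrightarrow> j < 2 * n \<Longrightarrow>
      Arg2pi ((if kind i = 0 then h (own i) else t (own i)) / (if kind 0 = 0 then h (own 0) else t (own 0))) <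
      Arg2pi ((if kind j = 0 then h (own j) else t (own j)) / (if kind 0 = 0 then h (own 0) else t (own 0)))"
begin

section \<open>Head counts, indices and the map \<open>R\<close>\<close>

definition pt :: "nat \<Rightarrow> complex" where
  "pt i = (if kind i = 0 then h (own i) else t (own i))"

definition pos :: "nat \<times> nat \<Rightarrow> nat" where
  "pos = the_inv_into {..<2 * n} (\<lambda>i. (own i, kind i))"

definition heads :: "nat \<Rightarrow> nat" where
  "heads i = card {k. k < i \<and> kind k = 0}"

definition idx :: "nat \<Rightarrow> nat" where
  "idx v = heads (pos (v, 0))"

text \<open>This is also the index of the first head after the tail of \<open>v\<close> in the
  sequence, or \<open>n\<close> if no head follows.\<close>

definition tails :: "nat \<Rightarrow> nat" where
  "tails v = heads (pos (v, 1))"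

definition ord :: "nat \<Rightarrow> nat" where
  "ord i = the_inv_into {..<n} idx (i mod n)"

text \<open>If \<open>j < e\<close>, the tail follows the head in the sequence and the last head met
  is \<open>e - 1\<close>. Otherwise the arc passes the start of the sequence and the index grows by
  \<open>n\<close>. Adding \<open>i - j\<close> returns to the period of \<open>i\<close>.\<close>

definition R :: "nat \<Rightarrow> nat" where
  "R i = (let j = i mod n; e = tails (ord j) in (if j < e then e - 1 else e + n - 1) + (i - j))"

lemma on_circle: "v < n \<Longrightarrow> h v \<in> sphere 0 1" "v < n \<Longrightarrow> t v \<in> sphere 0 1"
  using proper by (auto simp: proper_model_def intersection_model_def arc_family_def)

lemma pos:
  assumes "v < n" "k \<in> {0, 1}"
  shows "pos (v, k) < 2 * n" "own (pos (v, k)) = v" "kind (pos (v, k)) = k"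
proof -
  have vk: "(v, k) \<in> (\<lambda>i. (own i, kind i)) ` {..<2 * n}" and inj: "inj_on (\<lambda>i. (own i, kind i)) {..<2 * n}"
    using bij assms by (auto simp: bij_betw_def)
  show "pos (v, k) < 2 * n"
    using the_inv_into_into[OF inj vk subset_refl] by (simp add: pos_def)
  show "own (pos (v, k)) = v" "kind (pos (v, k)) = k"
    using f_the_inv_into_f[OF inj vk] by (auto simp: pos_def)
qed

lemma pos_eq: "i < 2 * n \<Longrightarrow> pos (own i, kind i) = i"
  using bij the_inv_into_f_f[of "\<lambda>i. (own i, kind i)" "{..<2 * n}" i] by (simp add: pos_def bij_betw_def)

lemma own_less: "i < 2 * n \<Longrightarrow> own i < n" and kind_cases: "i < 2 * n \<Longrightarrow> kind i = 0 \<or> kind i = 1"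
  using bij by (auto simp: bij_betw_def)

lemma heads_0: "heads 0 = 0"
  by (simp add: heads_def)

lemma heads_Suc: "heads (Suc i) = (if kind i = 0 then Suc (heads i) else heads i)"
proof -
  have "{k. k < Suc i \<and> kind k = 0} = (if kind i = 0 then insert i {k. k < i \<and> kind k = 0} else {k. k < i \<and> kind k = 0})"
    by (auto simp: less_Suc_eq)
  then show ?thesis by (simp add: heads_def)
qed

lemma heads_mono: "i \<le> j \<Longrightarrow> heads i \<le> heads j"
  unfolding heads_def by (intro card_mono) auto

lemma heads_less_iff: "kind i = 0 \<Longrightarrow> heads i < heads j \<longleftrightarrow> i < j"
  using heads_Suc[of i] heads_mono[of "Suc i" j] heads_mono[of j i] by (cases "i < j") auto

lemma heads_total: "heads (2 * n) = n"
proof -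
  have "{k. k < 2 * n \<and> kind k = 0} = (\<lambda>v. pos (v, 0)) ` {..<n}"
  proof (intro equalityI subsetI)
    fix k assume "k \<in> {k. k < 2 * n \<and> kind k = 0}"
    then have "k = pos (own k, 0)" "own k < n" using pos_eq[of k] own_less by auto
    then show "k \<in> (\<lambda>v. pos (v, 0)) ` {..<n}" by blast
  qed (use pos in auto)
  moreover have "inj_on (\<lambda>v. pos (v, 0)) {..<n}" 
    by (rule inj_on_inverseI[where g = own]) (use pos(2) in simp)
  ultimately show ?thesis by (simp add: heads_def card_image)
qed

lemma idx_less: "v < n \<Longrightarrow> idx v < n"
  using heads_less_iff[of "pos (v, 0)" "2 * n"] pos[of v 0] by (simp add: idx_def heads_total)

lemma tails_le: "v < n \<Longrightarrow> tails v \<le> n"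
  using heads_mono[of "pos (v, 1)" "2 * n"] pos[of v 1] by (simp add: tails_def heads_total)

lemma pos_head_less_iff: "u < n \<Longrightarrow> v < n \<Longrightarrow> pos (u, 0) < pos (v, 0) \<longleftrightarrow> idx u < idx v"
  using heads_less_iff[of "pos (u, 0)"] pos[of u 0] by (simp add: idx_def)

lemma pos_tail_less_iff: "u < n \<Longrightarrow> v < n \<Longrightarrow> pos (u, 0) < pos (v, 1) \<longleftrightarrow> idx u < tails v"
  using heads_less_iff[of "pos (u, 0)"] pos[of u 0] by (simp add: idx_def tails_def)

lemma bij_idx: "bij_betw idx {..<n} {..<n}"
proof -
  have "inj_on idx {..<n}"
  proof (rule inj_onI)
    fix u v assume uv: "u \<in> {..<n}" "v \<in> {..<n}" "idx u = idx v"
    then have "pos (u, 0) = pos (v, 0)"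
      using pos_head_less_iff[of u v] pos_head_less_iff[of v u] by auto
    then have "own (pos (u, 0)) = own (pos (v, 0))" by (rule arg_cong)
    moreover have "own (pos (u, 0)) = u" "own (pos (v, 0)) = v" using pos(2) uv(1,2) by simp_all
    ultimately show "u = v" by argo
  qed
  moreover have "idx ` {..<n} \<subseteq> {..<n}" using idx_less by auto
  ultimately show ?thesis by (simp add: bij_betw_def endo_inj_surj)
qed

lemma idx_ord: "idx (ord i) = i mod n" and ord_less: "ord i < n"
proof -
  have i: "i mod n \<in> idx ` {..<n}" and inj: "inj_on idx {..<n}"
    using bij_idx n3 by (auto simp: bij_betw_def)
  show "idx (ord i) = i mod n" using f_the_inv_into_f[OF inj i] by (simp add: ord_def)
  show "ord i < n" using the_inv_into_into[OF inj i subset_refl] by (simp add: ord_def)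
qed

lemma ord_idx: "v < n \<Longrightarrow> ord (idx v) = v"
  using bij_idx idx_less the_inv_into_f_f[of idx "{..<n}" v] by (simp add: ord_def bij_betw_def)

section \<open>Arc membership in terms of positions and indices\<close>

text \<open>Measured from \<open>pt 0\<close>, angles increase with the position. What remains is
  whether the way from \<open>x\<close> to \<open>q\<close> passes the start of the
  sequence.\<close>

lemma Arg2pi_le_iff:
  assumes P: "x < 2 * n" "y < 2 * n" "q < 2 * n" "x \<noteq> q"
  shows "Arg2pi (pt y / pt x) \<le> Arg2pi (pt q / pt x) \<longleftrightarrow>
    (if x < q then x \<le> y \<and> y \<le> q else x \<le> y \<or> y \<le> q)"
proof -
  let ?a = "\<lambda>i. Arg2pi (pt i / pt 0)"
  have less: "?a i < ?a j" if "i < j" "j < 2 * n" for i j using sorted[OF that] by (simp add: pt_def)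
  have a_less: "?a i < ?a j \<longleftrightarrow> i < j" if "i < 2 * n" "j < 2 * n" for i j
    using less[of i j] less[of j i] that by (cases i j rule: linorder_cases) auto
  then have a_le: "?a i \<le> ?a j \<longleftrightarrow> i \<le> j" if "i < 2 * n" "j < 2 * n" for i j
    using that by (meson linorder_not_less)
  have "pt i \<in> sphere 0 1" if "i < 2 * n" for i
    using on_circle own_less[OF that] by (simp add: pt_def)
  then have nz: "pt i \<noteq> 0" if "i < 2 * n" for i using that by force
  have nz0: "pt 0 \<noteq> 0" using nz n3 by simp
  have arith: "(if x \<le> y then y - x else y - x + 2 * pi) \<le> (if x \<le> q then q - x else q - x + 2 * pi) \<longleftrightarrow>
      (if x < q then x \<le> y \<and> y \<le> q else x \<le> y \<or> y \<le> q)"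
    if "0 \<le> y" "y < 2 * pi" "0 \<le> q" "q < 2 * pi" "x \<noteq> q" for x y q :: real
    using that by auto
  have ne: "?a x \<noteq> ?a q" using less[of x q] less[of q x] P by (cases "x < q") auto
  show ?thesis
    unfolding Arg2pi_divide_base[OF nz[OF P(2)] nz[OF P(1)] nz0]
      Arg2pi_divide_base[OF nz[OF P(3)] nz[OF P(1)] nz0]
      arith[OF Arg2pi_ge_0 Arg2pi_lt_2pi Arg2pi_ge_0 Arg2pi_lt_2pi ne]
    by (simp add: a_less a_le P)
qed

lemma head_in_arc_iff:
  assumes u: "u < n" and v: "v < n"
  shows "h v \<in> ccw_arc (h u) (t u) \<longleftrightarrow>
    (if idx u < tails u then idx u \<le> idx v \<and> idx v < tails u else idx u \<le> idx v \<or> idx v < tails u)"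
proof -
  let ?x = "pos (u, 0)" and ?q = "pos (u, 1)" and ?y = "pos (v, 0)"
  have P: "?x < 2 * n" "?y < 2 * n" "?q < 2 * n" using pos u v by auto
  have pt: "pt ?x = h u" "pt ?q = t u" "pt ?y = h v" using pos u v by (auto simp: pt_def)
  have "kind ?x = 0" "kind ?q = 1" "kind ?y = 0" using pos u v by auto
  \<comment> \<open>A head and a tail never share a position, so the comparison with the tail
    becomes strict, as in \<open>tails\<close>.\<close>
  then have neq: "?x \<noteq> ?q" "?y \<noteq> ?q" by auto
  have "h v \<in> ccw_arc (h u) (t u) \<longleftrightarrow> Arg2pi (pt ?y / pt ?x) \<le> Arg2pi (pt ?q / pt ?x)"
    unfolding pt using on_circle(1)[OF v] by (simp add: ccw_arc_def)
  also have "\<dots> \<longleftrightarrow> (if ?x < ?q then ?x \<le> ?y \<and> ?y < ?q else ?x \<le> ?y \<or> ?y < ?q)"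
    unfolding Arg2pi_le_iff[OF P neq(1)] using neq(2) by auto
  also have "\<dots> \<longleftrightarrow> (if idx u < tails u then idx u \<le> idx v \<and> idx v < tails u
      else idx u \<le> idx v \<or> idx v < tails u)"
    using pos_tail_less_iff[OF u u] pos_tail_less_iff[OF v u] pos_head_less_iff[OF v u]
    by (simp flip: linorder_not_less)
  finally show ?thesis .
qed

lemma periodic_induct [case_names less period]:
  assumes "\<And>i. i < n \<Longrightarrow> P i" "\<And>i. P i \<Longrightarrow> P (i + n)"
  shows "P (i :: nat)"
proof (induction i rule: less_induct)
  case (less i)
  show ?case
  proof (cases "i < n")
    case False
    then show ?thesis using assms(2)[OF less[of "i - n"]] n3 by simp
  qed (rule assms(1))
qed

lemma ord_period: "ord (i + n) = ord i"
  by (simp add: ord_def)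

lemma R_period: "R (i + n) = R i + n"
proof -
  have "i + n - i mod n = (i - i mod n) + n" by simp
  then show ?thesis unfolding R_def Let_def mod_add_self2 by (simp only: add.assoc)
qed

lemma R_less_n: "i < n \<Longrightarrow> R i = (if i < tails (ord i) then tails (ord i) - 1 else tails (ord i) + n - 1)"
  by (simp add: R_def Let_def)

lemma R_ge: "i \<le> R i" and R_less: "R i < i + n"
proof -
  have "i \<le> R i \<and> R i < i + n"
  proof (induction i rule: periodic_induct)
    case (less i)
    then show ?case using R_less_n[OF less] tails_le[OF ord_less, of i] n3 by auto
  next
    case (period i)
    then show ?case by (simp add: R_period)
  qed
  then show "i \<le> R i" "R i < i + n" by auto
qed

text \<open>This gives \<open>R\<close> its meaning. By periodicity \<open>i\<close> may lie in the
  first period; then \<open>l\<close> lies in the first or the second, matching the two cases of an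
  arc that does or does not pass the start.\<close>

lemma head_in_arc_ord:
  assumes "i < l" "l < i + n"
  shows "h (ord l) \<in> ccw_arc (h (ord i)) (t (ord i)) \<longleftrightarrow> l \<le> R i"
  using assms
proof (induction i arbitrary: l rule: periodic_induct)
  case (less i)
  have "tails (ord i) \<le> n" using tails_le ord_less by blast
  moreover have "l mod n = (if l < n then l else l - n)" using less by (auto simp: le_mod_geq)
  ultimately show ?case
    using less n3 unfolding head_in_arc_iff[OF ord_less ord_less] idx_ord R_less_n[OF less(1)] by auto
next
  case (period i)
  then have "n \<le> l" by simp
  then have "ord l = ord (l - n)" using ord_period[of "l - n"] by simp
  moreover have "h (ord (l - n)) \<in> ccw_arc (h (ord i)) (t (ord i)) \<longleftrightarrow> l - n \<le> R i"
    using period.prems by (intro period.IH) linarith+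
  moreover have "l - n \<le> R i \<longleftrightarrow> l \<le> R i + n" by linarith
  ultimately show ?case by (simp add: ord_period R_period)
qed

lemma ord_neq:
  assumes "i < l" "l < i + n"
  shows "ord i \<noteq> ord l"
proof -
  have "i mod n \<noteq> l mod n"
  proof
    assume "i mod n = l mod n"
    then have "n dvd l - i" by (metis mod_eq_dvd_iff_nat assms(1) less_imp_le)
    then have "n \<le> l - i" using assms(1) by (intro dvd_imp_le) auto
    then show False using assms by linarith
  qed
  then show ?thesis by (metis idx_ord)
qed

text \<open>Here properness enters: if \<open>Suc i\<close> did not reach the head
  \<open>R i\<close>, its arc would end before that head and be contained in the arc of
  \<open>i\<close>.\<close>

lemma R_Suc: "R i \<le> R (Suc i)"
proof (rule ccontr)
  let ?u = "ord i" and ?v = "ord (Suc i)" and ?w = "ord (R i)"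
  assume "\<not> R i \<le> R (Suc i)"
  then have l: "R (Suc i) < R i" "Suc i < R i" "R i < i + n" 
    using R_ge[of "Suc i"] R_less[of i] by linarith+
  have w: "h ?w \<in> ccw_arc (h ?u) (t ?u)" "h ?w \<notin> ccw_arc (h ?v) (t ?v)"
    using head_in_arc_ord[of i "R i"] head_in_arc_ord[of "Suc i" "R i"] l by auto
  have circle: "h ?u \<in> sphere 0 1" "h ?v \<in> sphere 0 1" "h ?w \<in> sphere 0 1"
    using on_circle ord_less by blast+
  have "Arg2pi (h ?v / h ?u) \<le> Arg2pi (h ?w / h ?u)"
  proof -
    let ?x = "pos (?u, 0)" and ?y = "pos (?v, 0)" and ?q = "pos (?w, 0)"
    have P: "?x < 2 * n" "?y < 2 * n" "?q < 2 * n" using pos(1)[OF ord_less] by simp_all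
    have pt: "pt ?x = h ?u" "pt ?y = h ?v" "pt ?q = h ?w"
      using pos(2,3)[OF ord_less] by (simp_all add: pt_def)
    have "?u \<noteq> ?w" using ord_neq[of i "R i"] l by simp
    then have neq: "?x \<noteq> ?q" using pos(2)[OF ord_less, of 0 i] pos(2)[OF ord_less, of 0 "R i"] by force
    have "idx ?v = (if Suc (idx ?u) = n then 0 else Suc (idx ?u))" by (simp add: idx_ord mod_Suc)
    moreover have "?x < ?q \<longleftrightarrow> idx ?u < idx ?w" "?y < ?x \<longleftrightarrow> idx ?v < idx ?u" "?q < ?y \<longleftrightarrow> idx ?w < idx ?v"
      using pos_head_less_iff ord_less by blast+
    ultimately have "if ?x < ?q then ?x \<le> ?y \<and> ?y \<le> ?q else ?x \<le> ?y \<or> ?y \<le> ?q"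
      using idx_less[OF ord_less[of "R i"]] by (auto simp flip: linorder_not_less split: if_splits)
    then show ?thesis using Arg2pi_le_iff[OF P neq] by (simp add: pt)
  qed
  then have "ccw_arc (h ?v) (t ?v) \<subseteq> ccw_arc (h ?u) (t ?u)"
    using ccw_arc_subset[OF circle] w by blast
  moreover have "?u \<noteq> ?v" using ord_neq[of i "Suc i"] n3 by simp
  ultimately show False using proper ord_less by (auto simp: proper_model_def)
qed

text \<open>Here density enters: a second arc covers the head of \<open>Suc i\<close>. Its index
  \<open>l\<close>, at most \<open>i + n\<close>, reaches \<open>Suc i + n\<close>, hence so does
  \<open>i + n\<close> by monotonicity.\<close>

lemma R_gt: "i < R i"
proof (induction i rule: periodic_induct)
  case (less i)
  let ?v = "ord (Suc i)"
  let ?D = "{u \<in> {..<n}. h ?v \<in> ccw_arc (h u) (t u)}"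
  have "\<not> ?D \<subseteq> {?v}"
    using dense[OF ord_less, of "Suc i"] card_mono[of "{?v}" ?D] by (auto simp: density_def)
  then obtain u where u: "u < n" "u \<noteq> ?v" "h ?v \<in> ccw_arc (h u) (t u)" by blast
  define l where "l = (if i < idx u then idx u else idx u + n)"
  have ul: "ord l = u" using ord_idx[OF u(1)] ord_period by (simp add: l_def)
  have "l \<noteq> Suc i" using ul u by auto
  then have l: "Suc i < l" "l \<le> i + n" using less idx_less[OF u(1)] by (auto simp: l_def)
  have "h (ord (Suc i + n)) \<in> ccw_arc (h (ord l)) (t (ord l))" using u ul ord_period by metis
  then have "Suc i + n \<le> R l" using head_in_arc_ord[of l "Suc i + n"] l by simp
  also have "\<dots> \<le> R (i + n)" using lift_Suc_mono_le[of R, OF R_Suc l(2)] .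
  finally show ?case by (simp add: R_period)
next
  case (period i)
  then show ?case by (simp add: R_period)
qed

lemma edge_iff: "{u, v} \<in> E \<longleftrightarrow> u < n \<and> v < n \<and> u \<noteq> v \<and>
    (h v \<in> ccw_arc (h u) (t u) \<or> h u \<in> ccw_arc (h v) (t v))"
proof -
  have E: "E = {{u, v} | u v. u \<in> {..<n} \<and> v \<in> {..<n} \<and> u \<noteq> v \<and>
      ccw_arc (h u) (t u) \<inter> ccw_arc (h v) (t v) \<noteq> {}}"
    using proper by (simp add: proper_model_def intersection_model_def)
  have "{u, v} \<in> E \<longleftrightarrow> u < n \<and> v < n \<and> u \<noteq> v \<and> ccw_arc (h u) (t u) \<inter> ccw_arc (h v) (t v) \<noteq> {}"
    unfolding E by (auto simp: doubleton_eq_iff)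
  also have "\<dots> \<longleftrightarrow> u < n \<and> v < n \<and> u \<noteq> v \<and>
    (h v \<in> ccw_arc (h u) (t u) \<or> h u \<in> ccw_arc (h v) (t v))"
    using ccw_arcs_meet_iff on_circle by blast
  finally show ?thesis .
qed

sublocale round_enumeration n "{..<n}" E ord R
proof
  show "ord ` {..<n} = {..<n}"
    using ord_less ord_idx idx_less by (force simp: image_iff)
  show "{ord i, ord j} \<in> E \<longleftrightarrow> j \<le> R i \<or> i + n \<le> R j" if "i < j" "j < i + n" for i j
    using head_in_arc_ord[OF that] head_in_arc_ord[of j "i + n"] ord_neq[OF that] that
    by (simp add: edge_iff ord_less ord_period)
  show "u \<in> {..<n} \<and> u \<noteq> v" if "{u, v} \<in> E" for u v
    using that by (simp add: edge_iff)
qed (use n3 ord_period R_period R_gt R_less R_Suc in auto)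

end

section \<open>Running time of loops with loop-free bodies\<close>

primrec loop_free :: "com \<Rightarrow> bool" where
  "loop_free Skip \<longleftrightarrow> True"
| "loop_free (Assign x e) \<longleftrightarrow> True"
| "loop_free (Store a e f) \<longleftrightarrow> True"
| "loop_free (Seq c d) \<longleftrightarrow> loop_free c \<and> loop_free d"
| "loop_free (Cond b c d) \<longleftrightarrow> loop_free c \<and> loop_free d"
| "loop_free (While b c) \<longleftrightarrow> False"

text \<open>The equations for \<open>While\<close> are junk: \<open>run\<close> and \<open>cost\<close> are meaningful for loop-free programs only.\<close>

primrec run :: "com \<Rightarrow> state \<Rightarrow> state" where
  "run Skip s = s"
| "run (Assign x e) s = s\<lparr>reg := (reg s)(x := aval e s)\<rparr>"
| "run (Store a e f) s = s\<lparr>arr := (arr s)(a := (arr s a)(aval e s := aval f s))\<rparr>"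
| "run (Seq c d) s = run d (run c s)"
| "run (Cond b c d) s = (if bval b s then run c s else run d s)"
| "run (While b c) s = s"

primrec cost :: "com \<Rightarrow> nat" where
  "cost Skip = 1"
| "cost (Assign x e) = acost e + 1"
| "cost (Store a e f) = acost e + acost f + 1"
| "cost (Seq c d) = cost c + cost d"
| "cost (Cond b c d) = bcost b + max (cost c) (cost d) + 1"
| "cost (While b c) = 0"

lemma exec_loop_free: "loop_free c \<Longrightarrow> \<exists>k\<le>cost c. exec c s k (run c s)"
proof (induction c arbitrary: s)
  case Skip
  then show ?case using exec.Skip[of s] by auto
next
  case (Assign x e)
  then show ?case using exec.Assign[of x e s] by auto
next
  case (Store a e f)
  then show ?case using exec.Store[of a e f s] by auto
next
  case (Seq c d)
  then obtain j k where "j \<le> cost c" "exec c s j (run c s)"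
    "k \<le> cost d" "exec d (run c s) k (run d (run c s))"
    by fastforce
  then have "exec (Seq c d) s (j + k) (run (Seq c d) s)" "j + k \<le> cost (Seq c d)"
    by (auto intro: exec.Seq)
  then show ?case by blast
next
  case (Cond b c d)
  then obtain j k where "j \<le> cost c" "exec c s j (run c s)" "k \<le> cost d" "exec d s k (run d s)"
    by fastforce
  then have "exec (Cond b c d) s (bcost b + (if bval b s then j else k) + 1) (run (Cond b c d) s)"
    "bcost b + (if bval b s then j else k) + 1 \<le> cost (Cond b c d)"
    using exec.CondTrue[of b s c j "run c s" d] exec.CondFalse[of b s d k "run d s" c] by auto
  then show ?case by blast
qed simp

text \<open>The invariant is indexed by the number of completed rounds, so termination and the time
  bound come out together with correctness.\<close>

lemma exec_while:
  assumes c: "loop_free c"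
    and step: "\<And>j s. j < N \<Longrightarrow> I j s \<Longrightarrow> bval b s \<and> I (Suc j) (run c s)"
    and stop: "\<And>s. I N s \<Longrightarrow> \<not> bval b s"
    and "j \<le> N" "I j s"
  shows "\<exists>k s'. exec (While b c) s k s' \<and> k \<le> (N - j) * (bcost b + cost c + 1) + bcost b + 1 \<and> I N s'"
  using assms(4,5)
proof (induction "N - j" arbitrary: j s)
  case 0
  then show ?case using exec.WhileFalse[of b s c] stop by (intro exI[of _ "bcost b + 1"] exI[of _ s]) auto
next
  case (Suc m)
  then have j: "j < N" "m = N - Suc j" "Suc j \<le> N" by auto
  obtain k1 where k1: "k1 \<le> cost c" "exec c s k1 (run c s)" using exec_loop_free[OF c] by blast
  obtain k2 s' where k2: "exec (While b c) (run c s) k2 s'" "I N s'"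
    "k2 \<le> (N - Suc j) * (bcost b + cost c + 1) + bcost b + 1"
    using Suc.hyps(1)[OF j(2,3)] step[OF j(1) Suc.prems(2)] by blast
  have "exec (While b c) s (bcost b + k1 + k2 + 1) s'"
    using exec.WhileTrue[OF _ k1(2) k2(1)] step[OF j(1) Suc.prems(2)] by blast
  moreover have "bcost b + k1 + k2 + 1 \<le> (N - j) * (bcost b + cost c + 1) + bcost b + 1"
    using k1(1) k2(3) Suc_diff_Suc[OF j(1)] by (simp flip: Suc_diff_Suc[OF j(1)])
  ultimately show ?case using k2(2) by blast
qed

text \<open>The factor 3 accounts for at most \<open>2 * n\<close> rounds and for the final failing
  test, which is bounded by \<open>n\<close> more rounds.\<close>

definition loop_cost :: "com \<Rightarrow> bexp \<Rightarrow> com \<Rightarrow> nat" where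
  "loop_cost init b c = cost init + 3 * (bcost b + cost c + 1)"

lemma exec_init_while:
  assumes "loop_free init" "loop_free c" "0 < n" "N \<le> 2 * n"
    and "I 0 (run init s)"
    and "\<And>j s. j < N \<Longrightarrow> I j s \<Longrightarrow> bval b s \<and> I (Suc j) (run c s)"
    and "\<And>s. I N s \<Longrightarrow> \<not> bval b s"
  shows "\<exists>k s'. exec (Seq init (While b c)) s k s' \<and> k \<le> loop_cost init b c * n \<and> I N s'"
proof -
  obtain k1 where k1: "k1 \<le> cost init" "exec init s k1 (run init s)"
    using exec_loop_free[OF assms(1)] by blast
  define X where "X = bcost b + cost c + 1"
  obtain k2 s' where k2: "exec (While b c) (run init s) k2 s'" "I N s'" "k2 \<le> N * X + bcost b + 1"
    using exec_while[of c N I b 0, OF assms(2,6,7) le0 assms(5)] unfolding diff_zero X_def by blast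
  have "N * X \<le> 2 * (n * X)" using mult_le_mono1[OF assms(4), of X] by (simp only: mult.assoc)
  moreover have "X \<le> n * X" using assms(3) by simp
  moreover have "bcost b + 1 \<le> X" by (simp add: X_def)
  ultimately have "k2 \<le> 3 * (n * X)" using k2(3) by linarith
  moreover have "cost init \<le> n * cost init" using assms(3) by simp
  ultimately have "k1 + k2 \<le> n * cost init + 3 * (n * X)" using k1(1) by linarith
  also have "\<dots> = loop_cost init b c * n" by (simp add: loop_cost_def X_def algebra_simps)
  finally show ?thesis using exec.Seq[OF k1(2) k2(1)] k2(2) by blast
qed

section \<open>The program\<close>

definition order_init :: com where
  "order_init = Seq (Assign ''i'' (Const 0)) (Assign ''c'' (Const 0))"

definition order_test :: bexp where
  "order_test = Less (Var ''i'') (Plus (Var ''n'') (Var ''n''))"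

text \<open>The second copy at distance \<open>n\<close> lets later loops read indices below
  \<open>2 * n\<close> without a modulo operation.\<close>

definition order_body :: com where
  "order_body =
     Seq (Cond (Equal (Elem ''kind'' (Var ''i'')) (Const 0))
            (Seq (Store ''ord'' (Var ''c'') (Elem ''own'' (Var ''i'')))
            (Seq (Store ''ord'' (Plus (Var ''c'') (Var ''n'')) (Elem ''own'' (Var ''i'')))
                 (Assign ''c'' (Plus (Var ''c'') (Const 1)))))
            (Store ''end'' (Elem ''own'' (Var ''i'')) (Var ''c'')))
         (Assign ''i'' (Plus (Var ''i'') (Const 1)))"

definition reach_init :: com where
  "reach_init = Assign ''j'' (Const 0)"

definition reach_test :: bexp where
  "reach_test = Less (Var ''j'') (Var ''n'')"

definition reach_body :: com where
  "reach_body =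
     Seq (Assign ''r'' (Elem ''end'' (Elem ''ord'' (Var ''j''))))
    (Seq (Cond (Less (Var ''j'') (Var ''r''))
            (Assign ''r'' (Minus (Var ''r'') (Const 1)))
            (Assign ''r'' (Minus (Plus (Var ''r'') (Var ''n'')) (Const 1))))
    (Seq (Store ''R'' (Var ''j'') (Var ''r''))
    (Seq (Store ''R'' (Plus (Var ''j'') (Var ''n'')) (Plus (Var ''r'') (Var ''n'')))
         (Assign ''j'' (Plus (Var ''j'') (Const 1))))))"

definition path_init :: com where
  "path_init = Seq (Assign ''x'' (Const 0)) (Seq (Assign ''s'' (Const 0)) (Assign ''f'' (Const 0)))"

text \<open>The last possible start \<open>n - 1\<close> is decided at
  \<open>x = 2 * n - 4\<close>.\<close>

definition path_test :: bexp where
  "path_test = Less (Plus (Var ''x'') (Const 3)) (Plus (Var ''n'') (Var ''n''))"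

text \<open>\<open>s\<close> is where the current run of indices \<open>y\<close> with
  \<open>R y \<noteq> Suc y\<close> begins; a cut at \<open>s\<close> works once the run has
  \<open>n - 2\<close> members, that is \<open>s + n \<le> x + 3\<close>.\<close>

definition path_body :: com where
  "path_body =
     Seq (Cond (Equal (Elem ''R'' (Var ''x'')) (Plus (Var ''x'') (Const 1)))
            (Assign ''s'' (Plus (Var ''x'') (Const 1))) Skip)
    (Seq (Cond (Less (Plus (Var ''x'') (Const 3)) (Plus (Var ''s'') (Var ''n'')))
            Skip (Seq (Assign ''f'' (Const 1)) (Assign ''p'' (Var ''s''))))
         (Assign ''x'' (Plus (Var ''x'') (Const 1))))"

definition triangle_init :: com where
  "triangle_init = Seq (Assign ''a'' (Const 0)) (Assign ''g'' (Const 0))"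

definition triangle_test :: bexp where
  "triangle_test = Less (Var ''a'') (Var ''n'')"

text \<open>Since \<open>triangle\<close> determines \<open>b\<close> and \<open>c\<close> from
  \<open>a\<close>, one candidate per \<open>a\<close> is tested. The negated conjunction of
  negations encodes the disjunction in \<open>triangle\<close>.\<close>

definition triangle_body :: com where
  "triangle_body =
     Seq (Assign ''b'' (Elem ''R'' (Var ''a'')))
    (Seq (Assign ''c'' (Elem ''R'' (Var ''b'')))
    (Seq (Cond (Less (Var ''c'') (Plus (Var ''a'') (Var ''n''))) Skip
            (Assign ''c'' (Minus (Plus (Var ''a'') (Var ''n'')) (Const 1))))
    (Seq (Cond (BAnd (BAnd (Less (Var ''b'') (Var ''c''))
                   (BNot (Less (Elem ''R'' (Var ''c'')) (Plus (Var ''a'') (Var ''n'')))))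
                 (BNot (BAnd (BNot (Equal (Var ''c'') (Plus (Var ''b'') (Const 1))))
                   (BNot (Less (Var ''c'') (Elem ''R'' (Minus (Var ''c'') (Const 1))))))))
            (Seq (Assign ''g'' (Const 1))
            (Seq (Assign ''ta'' (Var ''a'')) (Seq (Assign ''tb'' (Var ''b'')) (Assign ''tc'' (Var ''c'')))))
            Skip)
         (Assign ''a'' (Plus (Var ''a'') (Const 1))))))"

definition output_init :: com where
  "output_init =
     Seq (Cond (Equal (Var ''f'') (Const 1))
            (Seq (Assign ''q'' (Var ''p'')) (Assign ''ans'' (Const 1)))
            (Seq (Assign ''q'' (Var ''ta'')) (Assign ''ans'' (Var ''g''))))
         (Assign ''i'' (Const 0))"

definition output_test :: bexp where
  "output_test = Less (Plus (Var ''i'') (Const 1)) (Var ''n'')"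

definition output_body :: com where
  "output_body =
     Seq (Assign ''j'' (Plus (Plus (Var ''q'') (Var ''i'')) (Const 1)))
    (Seq (Cond (Equal (Var ''f'') (Const 1))
            (Assign ''r'' (Minus (Var ''j'') (Const 1)))
            (Cond (BAnd (Less (Var ''tb'') (Var ''j'')) (BNot (Equal (Var ''j'') (Var ''tc''))))
              (Assign ''r'' (Var ''tc'')) (Assign ''r'' (Var ''q''))))
    (Seq (Store ''src'' (Var ''i'') (Elem ''ord'' (Var ''r'')))
    (Seq (Store ''dst'' (Var ''i'') (Elem ''ord'' (Var ''j'')))
         (Assign ''i'' (Plus (Var ''i'') (Const 1))))))"

definition lcst_program :: com where
  "lcst_program =
     Seq (Seq order_init (While order_test order_body))
    (Seq (Seq reach_init (While reach_test reach_body))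
    (Seq (Seq path_init (While path_test path_body))
    (Seq (Seq triangle_init (While triangle_test triangle_body))
         (Seq output_init (While output_test output_body)))))"

definition lcst_cost :: nat where
  "lcst_cost = loop_cost order_init order_test order_body + loop_cost reach_init reach_test reach_body +
     loop_cost path_init path_test path_body + loop_cost triangle_init triangle_test triangle_body +
     loop_cost output_init output_test output_body"

section \<open>Correctness of the program\<close>

context endpoint_sequence
begin

section \<open>Loop invariants\<close>

definition order_inv :: "nat \<Rightarrow> state \<Rightarrow> bool" where
  "order_inv i s \<longleftrightarrow> reg s ''n'' = n \<and> reg s ''i'' = i \<and> reg s ''c'' = heads i \<and>
     arr s ''own'' = own \<and> arr s ''kind'' = kind \<and>
     (\<forall>l<heads i. arr s ''ord'' l = ord l \<and> arr s ''ord'' (l + n) = ord l) \<and>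
     (\<forall>v<n. pos (v, 1) < i \<longrightarrow> arr s ''end'' v = tails v)"

definition ordered :: "state \<Rightarrow> bool" where
  "ordered s \<longleftrightarrow> reg s ''n'' = n \<and> (\<forall>i<2 * n. arr s ''ord'' i = ord i)"

definition reach_inv :: "nat \<Rightarrow> state \<Rightarrow> bool" where
  "reach_inv j s \<longleftrightarrow> ordered s \<and> (\<forall>v<n. arr s ''end'' v = tails v) \<and> reg s ''j'' = j \<and>
     (\<forall>l<j. arr s ''R'' l = R l \<and> arr s ''R'' (l + n) = R l + n)"

definition reached :: "state \<Rightarrow> bool" where
  "reached s \<longleftrightarrow> ordered s \<and> (\<forall>i<2 * n. arr s ''R'' i = R i)"

definition path_from :: "nat \<Rightarrow> bool" where
  "path_from p \<longleftrightarrow> (\<forall>x. p \<le> x \<and> x + 2 < p + n \<longrightarrow> R x \<noteq> Suc x)"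

text \<open>A start \<open>p\<close> is decided once its last test index \<open>p + n - 3\<close> is
  below \<open>x\<close>. The condition at \<open>reg s ''s'' - 1\<close> says that the current run
  cannot be extended to the left; it refutes the earlier starts.\<close>

definition path_inv :: "nat \<Rightarrow> state \<Rightarrow> bool" where
  "path_inv x s \<longleftrightarrow> reached s \<and> reg s ''x'' = x \<and>
     reg s ''s'' \<le> x \<and> (reg s ''s'' = 0 \<or> R (reg s ''s'' - 1) = reg s ''s'') \<and>
     (\<forall>y. reg s ''s'' \<le> y \<and> y < x \<longrightarrow> R y \<noteq> Suc y) \<and>
     (reg s ''f'' = 0 \<and> (\<forall>p. p + n \<le> x + 2 \<longrightarrow> \<not> path_from p) \<or>
      reg s ''f'' = 1 \<and> reg s ''p'' < n \<and> path_from (reg s ''p''))"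

definition path_searched :: "state \<Rightarrow> bool" where
  "path_searched s \<longleftrightarrow> reached s \<and>
     (reg s ''f'' = 0 \<and> (\<forall>p<n. \<not> path_from p) \<or>
      reg s ''f'' = 1 \<and> reg s ''p'' < n \<and> path_from (reg s ''p''))"

definition triangle_inv :: "nat \<Rightarrow> state \<Rightarrow> bool" where
  "triangle_inv a s \<longleftrightarrow> path_searched s \<and> reg s ''a'' = a \<and>
     (reg s ''g'' = 0 \<and> (\<forall>a'<a. \<forall>b c. \<not> triangle a' b c) \<or>
      reg s ''g'' = 1 \<and> reg s ''ta'' < n \<and> triangle (reg s ''ta'') (reg s ''tb'') (reg s ''tc''))"

text \<open>The tree is described by its root and parent map on indices; \<open>A\<close> is the content of \<open>ord\<close>.\<close>

definition output_inv :: "(nat \<Rightarrow> nat) \<Rightarrow> nat \<Rightarrow> nat \<Rightarrow> nat \<Rightarrow> nat \<Rightarrow> nat \<Rightarrow> nat \<Rightarrow> state \<Rightarrow> bool" where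
  "output_inv A f q b c w i s \<longleftrightarrow> reg s ''n'' = n \<and> arr s ''ord'' = A \<and> reg s ''f'' = f \<and> reg s ''q'' = q \<and>
     reg s ''tb'' = b \<and> reg s ''tc'' = c \<and> reg s ''ans'' = w \<and> reg s ''i'' = i \<and>
     (\<forall>l<i. arr s ''src'' l =
         A (if f = 1 then q + l else if q + l + 1 \<le> b \<or> q + l + 1 = c then q else c) \<and>
       arr s ''dst'' l = A (q + l + 1))"

section \<open>Preservation of the invariants\<close>

lemma order_step:
  assumes "i < 2 * n" "order_inv i s"
  shows "bval order_test s \<and> order_inv (Suc i) (run order_body s)"
proof (cases "kind i = 0")
  case True
  have "idx (own i) = heads i" using pos_eq[OF assms(1)] True by (simp add: idx_def)
  then have "ord (heads i) = own i" "heads i < n"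
    using ord_idx[OF own_less[OF assms(1)]] idx_less[OF own_less[OF assms(1)]] by simp_all
  moreover have "pos (v, 1) \<noteq> i" if "v < n" for v using pos(3)[OF that, of 1] True by auto
  ultimately show ?thesis
    using assms True
    by (auto simp: order_inv_def order_test_def order_body_def heads_Suc less_Suc_eq)
next
  case False
  then have k: "kind i = 1" using kind_cases[OF assms(1)] by simp
  have "tails (own i) = heads i" using pos_eq[OF assms(1)] k by (simp add: tails_def)
  moreover have "pos (v, 1) < Suc i \<longleftrightarrow> pos (v, 1) < i \<or> v = own i" if "v < n" for v
    using pos(2)[OF that, of 1] pos_eq[OF assms(1)] k by (auto simp: less_Suc_eq)
  ultimately show ?thesis
    using assms False
    by (simp add: order_inv_def order_test_def order_body_def heads_Suc)
qed

lemma reach_step: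
  assumes "j < n" "reach_inv j s"
  shows "bval reach_test s \<and> reach_inv (Suc j) (run reach_body s)"
proof -
  have "arr s ''ord'' j = ord j" "arr s ''end'' (ord j) = tails (ord j)"
    using assms ord_less by (auto simp: reach_inv_def ordered_def)
  then show ?thesis
    using assms R_less_n[OF assms(1)]
    by (auto simp: reach_inv_def reach_test_def reach_body_def ordered_def less_Suc_eq)
qed

lemma path_step:
  assumes x: "x < 2 * n - 3" and inv: "path_inv x s"
  shows "bval path_test s \<and> path_inv (Suc x) (run path_body s)"
proof -
  define q where "q = (if R x = Suc x then Suc x else reg s ''s'')"
  have Rx: "arr s ''R'' x = R x" and n: "reg s ''n'' = n" and sx: "reg s ''x'' = x"
    using inv x by (auto simp: path_inv_def reached_def ordered_def)
  have q: "q \<le> Suc x" "q = 0 \<or> R (q - 1) = q" "\<forall>y. q \<le> y \<and> y < Suc x \<longrightarrow> R y \<noteq> Suc y"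
    using inv by (auto simp: path_inv_def q_def less_Suc_eq)
  have found: "path_from q \<and> q < n" if "q + n \<le> x + 3"
    using q(3) that x by (auto simp: path_from_def)
  \<comment> \<open>Only \<open>p = x + 3 - n\<close> is newly decided. It lies before
    \<open>q\<close>, and the violation at \<open>q - 1\<close> falls among its test
    indices.\<close>
  have not_found: "\<not> path_from p" if "\<not> q + n \<le> x + 3" "p + n = x + 3" for p
  proof -
    have "p \<le> q - 1" "q - 1 + 2 < p + n" "R (q - 1) = Suc (q - 1)" using that q(1,2) n3 by auto
    then show ?thesis unfolding path_from_def by blast
  qed
  have old: "\<forall>p. p + n \<le> x + 3 \<longrightarrow> \<not> path_from p"
    if "\<not> q + n \<le> x + 3" "\<forall>p. p + n \<le> x + 2 \<longrightarrow> \<not> path_from p"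
    using not_found[OF that(1)] that(2) by (metis add_Suc_right le_Suc_eq numeral_2_eq_2 numeral_3_eq_3)
  have "bval path_test s" using x by (auto simp: path_test_def n sx)
  moreover have s': "reg (run path_body s) ''s'' = q" "reg (run path_body s) ''x'' = Suc x"
    "arr (run path_body s) = arr s" "reg (run path_body s) ''n'' = n"
    "reg (run path_body s) ''f'' = (if q + n \<le> x + 3 then 1 else reg s ''f'')"
    "reg (run path_body s) ''p'' = (if q + n \<le> x + 3 then q else reg s ''p'')"
    by (auto simp: path_body_def n sx Rx q_def)
  moreover have "reached (run path_body s)"
    using inv s' by (simp add: path_inv_def reached_def ordered_def)
  ultimately show ?thesis
    using q found old inv unfolding path_inv_def s' by (auto simp: numeral_2_eq_2 numeral_3_eq_3)
qed

lemma triangle_step: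
  assumes a: "a < n" and inv: "triangle_inv a s"
  shows "bval triangle_test s \<and> triangle_inv (Suc a) (run triangle_body s)"
proof -
  define b where "b = R a"
  define c where "c = min (R b) (a + n - 1)"
  have Rarr: "\<And>i. i < 2 * n \<Longrightarrow> arr s ''R'' i = R i" and n: "reg s ''n'' = n" and sa: "reg s ''a'' = a"
    using inv by (auto simp: triangle_inv_def path_searched_def reached_def ordered_def)
  have "b < 2 * n" "c < 2 * n" using R_less[of a] a n3 by (auto simp: b_def c_def)
  then have Rs: "arr s ''R'' a = b" "arr s ''R'' b = R b" "arr s ''R'' c = R c"
    "arr s ''R'' (c - Suc 0) = R (c - 1)"
    using Rarr a by (auto simp: b_def)
  have c: "c = (if R b < a + n then R b else a + n - Suc 0)" by (auto simp: c_def)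
  have none: "\<forall>b' c'. \<not> triangle a b' c'" if "\<not> triangle a b c"
    using that by (auto simp: triangle_def b_def c_def)
  have tri': "triangle a b c \<longleftrightarrow> (b < c \<and> \<not> R c < a + n) \<and> \<not> (c \<noteq> Suc b \<and> \<not> c < R (c - 1))"
    by (auto simp: triangle_def b_def c_def)
  have s': "arr (run triangle_body s) = arr s" "reg (run triangle_body s) ''a'' = Suc a"
    "reg (run triangle_body s) ''n'' = n"
    "reg (run triangle_body s) ''f'' = reg s ''f''" "reg (run triangle_body s) ''p'' = reg s ''p''"
    "reg (run triangle_body s) ''g'' = (if triangle a b c then 1 else reg s ''g'')"
    "reg (run triangle_body s) ''ta'' = (if triangle a b c then a else reg s ''ta'')"
    "reg (run triangle_body s) ''tb'' = (if triangle a b c then b else reg s ''tb'')"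
    "reg (run triangle_body s) ''tc'' = (if triangle a b c then c else reg s ''tc'')"
    using Rs(3,4) unfolding tri'
    by (auto simp: triangle_body_def n sa Rs(1,2) c split: if_splits)
  have "path_searched (run triangle_body s)"
    using inv s' by (simp add: triangle_inv_def path_searched_def reached_def ordered_def)
  moreover have "bval triangle_test s" using a by (simp add: triangle_test_def n sa)
  ultimately show ?thesis
    using a inv none unfolding triangle_inv_def s' 
    by (cases "triangle a b c") (auto simp: less_Suc_eq)
qed

lemma output_step:
  assumes "i < n - 1" "output_inv A f q b c w i s"
  shows "bval output_test s \<and> output_inv A f q b c w (Suc i) (run output_body s)"
  using assms
  by (auto simp: output_inv_def output_test_def output_body_def less_Suc_eq)

lemma loop_free_program:
  "loop_free order_init" "loop_free order_body" "loop_free reach_init" "loop_free reach_body"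
  "loop_free path_init" "loop_free path_body" "loop_free triangle_init" "loop_free triangle_body"
  "loop_free output_init" "loop_free output_body"
  by (simp_all add: order_init_def order_body_def reach_init_def reach_body_def path_init_def
      path_body_def triangle_init_def triangle_body_def output_init_def output_body_def)

lemma tests_stop:
  "order_inv (2 * n) s \<Longrightarrow> \<not> bval order_test s"
  "reach_inv n s \<Longrightarrow> \<not> bval reach_test s"
  "path_inv (2 * n - 3) s \<Longrightarrow> \<not> bval path_test s"
  "triangle_inv n s \<Longrightarrow> \<not> bval triangle_test s"
  "output_inv A f q b c w (n - 1) s \<Longrightarrow> \<not> bval output_test s"
  by (auto simp: order_inv_def order_test_def reach_inv_def reach_test_def path_inv_def path_test_def
      triangle_inv_def triangle_test_def output_inv_def output_test_def path_searched_def reached_def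
      ordered_def)

lemma parent_edges_reindex:
  "{{A (p l), A (q + l + 1)} | l. l < n - 1} = {{A (p (j - q - 1)), A j} | j. q < j \<and> j < q + n}"
proof (intro equalityI subsetI)
  fix e assume "e \<in> {{A (p l), A (q + l + 1)} | l. l < n - 1}"
  then obtain l where "l < n - 1" "e = {A (p l), A (q + l + 1)}" by blast
  then show "e \<in> {{A (p (j - q - 1)), A j} | j. q < j \<and> j < q + n}"
    by (intro CollectI exI[of _ "q + l + 1"]) auto
next
  fix e assume "e \<in> {{A (p (j - q - 1)), A j} | j. q < j \<and> j < q + n}"
  then obtain j where "q < j" "j < q + n" "e = {A (p (j - q - 1)), A j}" by blast
  then show "e \<in> {{A (p l), A (q + l + 1)} | l. l < n - 1}"
    by (intro CollectI exI[of _ "j - q - 1"]) auto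
qed

text \<open>All indices that are read lie below \<open>2 * n\<close>, where \<open>A\<close> agrees
  with \<open>ord\<close>; for the parent \<open>c\<close> this is the assumed bound.\<close>

lemma output_edges_inv:
  assumes "output_inv A f q b c w (n - 1) s" "\<And>i. i < 2 * n \<Longrightarrow> A i = ord i" "q < n" "f = 1 \<or> c < 2 * n"
  shows "output_edges n s =
    {{ord (if f = 1 then j - 1 else if j \<le> b \<or> j = c then q else c), ord j} | j. q < j \<and> j < q + n}"
proof -
  let ?p = "\<lambda>j. if f = 1 then j - 1 else if j \<le> b \<or> j = c then q else c"
  have "output_edges n s = {{A (?p (q + l + 1)), A (q + l + 1)} | l. l < n - 1}"
  proof -
    have "{arr s ''src'' l, arr s ''dst'' l} = {A (?p (q + l + 1)), A (q + l + 1)}" if "l < n - 1" for l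
      using assms(1) that by (simp add: output_inv_def)
    then show ?thesis unfolding output_edges_def by (metis (no_types, lifting))
  qed
  also have "\<dots> = {{A (?p (q + (j - q - 1) + 1)), A j} | j. q < j \<and> j < q + n}"
    by (rule parent_edges_reindex)
  also have "\<dots> = {{ord (?p j), ord j} | j. q < j \<and> j < q + n}"
  proof -
    have "{A (?p (q + (j - q - 1) + 1)), A j} = {ord (?p j), ord j}" if "q < j" "j < q + n" for j
    proof -
      have "q + (j - q - 1) + 1 = j" using that by simp
      moreover have "A (?p j) = ord (?p j)" "A j = ord j" using assms(2-4) that by auto
      ultimately show ?thesis by presburger
    qed
    then show ?thesis by (metis (no_types, lifting))
  qed
  finally show ?thesis .
qed

lemma lcst_program_correct:
  assumes "reg s ''n'' = n" "arr s ''own'' = own" "arr s ''kind'' = kind"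
  shows "\<exists>k s'. exec lcst_program s k s' \<and> k \<le> lcst_cost * n \<and>
    (if \<exists>T. locally_connected_spanning_tree {..<n} E T
     then reg s' ''ans'' = 1 \<and> locally_connected_spanning_tree {..<n} E (output_edges n s')
     else reg s' ''ans'' = 0)"
proof -
  have n0: "0 < n" and n2: "n \<le> 2 * n" "n - 1 \<le> 2 * n" using n3 by simp_all
  have init: "order_inv 0 (run order_init s)"
    using assms by (simp add: order_inv_def order_init_def heads_0)
  obtain k1 s1 where 1: "exec (Seq order_init (While order_test order_body)) s k1 s1"
    "k1 \<le> loop_cost order_init order_test order_body * n" "order_inv (2 * n) s1"
    using exec_init_while[where I = order_inv, OF loop_free_program(1,2) n0 order_refl _ order_step tests_stop(1)] init
    by blast
  have "ordered s1"
  proof -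
    have "arr s1 ''ord'' i = ord i" if i: "i < 2 * n" for i
    proof (cases "i < n")
      case True
      then show ?thesis using 1(3) by (simp add: order_inv_def heads_total)
    next
      case False
      then have l: "i = (i - n) + n" "i - n < n" using i by linarith+
      then have "arr s1 ''ord'' (i - n + n) = ord (i - n)" using 1(3) unfolding order_inv_def heads_total by blast
      then show ?thesis using l(1) ord_period by metis
    qed
    then show ?thesis using 1(3) by (simp add: ordered_def order_inv_def)
  qed
  moreover have "\<forall>v<n. arr s1 ''end'' v = tails v" using 1(3) pos(1)[of _ 1] by (simp add: order_inv_def)
  ultimately have "reach_inv 0 (run reach_init s1)"
    by (simp add: reach_inv_def reach_init_def ordered_def)
  then obtain k2 s2 where 2: "exec (Seq reach_init (While reach_test reach_body)) s1 k2 s2"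
    "k2 \<le> loop_cost reach_init reach_test reach_body * n" "reach_inv n s2"
    using exec_init_while[where I = reach_inv, OF loop_free_program(3,4) n0 n2(1) _ reach_step tests_stop(2)]
    by blast
  have "reached s2"
  proof -
    have "arr s2 ''R'' i = R i" if i: "i < 2 * n" for i
    proof (cases "i < n")
      case True
      then show ?thesis using 2(3) by (simp add: reach_inv_def)
    next
      case False
      then have l: "i = (i - n) + n" "i - n < n" using i by linarith+
      then have "arr s2 ''R'' (i - n + n) = R (i - n) + n" using 2(3) unfolding reach_inv_def by blast
      then show ?thesis using l(1) R_period by metis
    qed
    then show ?thesis using 2(3) by (simp add: reached_def reach_inv_def)
  qed
  then have "path_inv 0 (run path_init s2)"
    using n3 by (simp add: path_inv_def path_init_def reached_def ordered_def)
  then obtain k3 s3 where 3: "exec (Seq path_init (While path_test path_body)) s2 k3 s3"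
    "k3 \<le> loop_cost path_init path_test path_body * n" "path_inv (2 * n - 3) s3"
    using exec_init_while[where I = path_inv, OF loop_free_program(5,6) n0 diff_le_self _ path_step tests_stop(3)]
    by blast
  have "path_searched s3" using 3(3) n3 by (auto simp: path_inv_def path_searched_def)
  then have "triangle_inv 0 (run triangle_init s3)"
    by (simp add: triangle_inv_def triangle_init_def path_searched_def reached_def ordered_def)
  then obtain k4 s4 where 4: "exec (Seq triangle_init (While triangle_test triangle_body)) s3 k4 s4"
    "k4 \<le> loop_cost triangle_init triangle_test triangle_body * n" "triangle_inv n s4"
    using exec_init_while[where I = triangle_inv, OF loop_free_program(7,8) n0 n2(1) _ triangle_step tests_stop(4)]
    by blast
  \<comment> \<open>The values that the last loop only reads are fixed here, so its invariant need
    not mention the state before it.\<close>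
  define A f b c where "A = arr s4 ''ord''" and "f = reg s4 ''f''" and "b = reg s4 ''tb''" and "c = reg s4 ''tc''"
  define q where "q = (if f = 1 then reg s4 ''p'' else reg s4 ''ta'')"
  define w where "w = (if f = 1 then 1 else reg s4 ''g'')"
  have s4: "reg s4 ''n'' = n" "\<And>i. i < 2 * n \<Longrightarrow> A i = ord i"
    using 4(3) by (auto simp: triangle_inv_def path_searched_def reached_def ordered_def A_def)
  have path: "f = 0 \<and> (\<forall>p<n. \<not> path_from p) \<or> f = 1 \<and> reg s4 ''p'' < n \<and> path_from (reg s4 ''p'')"
    using 4(3) unfolding triangle_inv_def path_searched_def f_def by blast
  have tri: "reg s4 ''g'' = 0 \<and> (\<forall>a<n. \<forall>b c. \<not> triangle a b c) \<or>
      reg s4 ''g'' = 1 \<and> reg s4 ''ta'' < n \<and> triangle (reg s4 ''ta'') b c"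
    using 4(3) unfolding triangle_inv_def b_def c_def by blast
  have "output_inv A f q b c w 0 (run output_init s4)"
    using s4(1) by (simp add: output_inv_def output_init_def A_def f_def b_def c_def q_def w_def)
  then obtain k5 s5 where 5: "exec (Seq output_init (While output_test output_body)) s4 k5 s5"
    "k5 \<le> loop_cost output_init output_test output_body * n" "output_inv A f q b c w (n - 1) s5"
    using exec_init_while[where I = "output_inv A f q b c w",
        OF loop_free_program(9,10) n0 n2(2) _ output_step
          tests_stop(5)[of A f q b c w]]
    by blast
  have ans: "reg s5 ''ans'' = w" using 5(3) by (simp add: output_inv_def)
  have lcst: "locally_connected_spanning_tree {..<n} E (output_edges n s5)" if "w = 1"
  proof (cases "f = 1")
    case True
    have q: "q < n" "path_from q" using path True by (auto simp: q_def)
    have "output_edges n s5 = {{ord (j - 1), ord j} | j. q < j \<and> j < q + n}"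
      using output_edges_inv[OF 5(3) s4(2) q(1)] True by simp
    then show ?thesis using path_lcst[of q] q(2) by (simp add: path_from_def)
  next
    case False
    then have q: "q < n" "triangle q b c" using tri that by (auto simp: q_def w_def)
    then have "c < 2 * n" using n3 by (auto simp: triangle_def)
    then show ?thesis
      using triangle_lcst[OF q(2)] False output_edges_inv[OF 5(3) s4(2) q(1)] by simp
  qed
  have none: "\<not> locally_connected_spanning_tree {..<n} E T" if "w \<noteq> 1" for T
  proof
    assume "locally_connected_spanning_tree {..<n} E T"
    then have "(\<exists>p<n. path_from p) \<or> (\<exists>a<n. \<exists>b c. triangle a b c)"
      unfolding path_from_def by (rule lcst_path_or_triangle)
    moreover have "f \<noteq> 1" "reg s4 ''g'' \<noteq> 1" using that by (auto simp: w_def split: if_splits)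
    ultimately show False using path tri by blast
  qed
  have w01: "w = 0 \<or> w = 1" using tri by (auto simp: w_def)
  have "exec lcst_program s (k1 + (k2 + (k3 + (k4 + k5)))) s5"
    unfolding lcst_program_def by (intro exec.Seq[OF 1(1)] exec.Seq[OF 2(1)] exec.Seq[OF 3(1)] exec.Seq[OF 4(1)] 5(1))
  moreover have "k1 + (k2 + (k3 + (k4 + k5))) \<le> lcst_cost * n"
    using 1(2) 2(2) 3(2) 4(2) 5(2) unfolding lcst_cost_def distrib_right by linarith
  ultimately show ?thesis using ans lcst none w01 by (intro exI conjI) auto
qed

end

theorem theorem2:
  shows "\<exists>(prog :: com) (C :: nat).
    \<forall>(n :: nat) (E :: nat set set) (h :: nat \<Rightarrow> complex) (t :: nat \<Rightarrow> complex) (s :: state).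
      n \<ge> 3 \<and> proper_model {..<n} E h t \<and> (\<forall>v<n. density {..<n} h t v \<ge> 2) \<and>
      input_state n E h t s \<longrightarrow>
      (\<exists>k s'. exec prog s k s' \<and> k \<le> C * (n + card E) \<and>
        (if \<exists>T. locally_connected_spanning_tree {..<n} E T
         then reg s' ''ans'' = 1 \<and> locally_connected_spanning_tree {..<n} E (output_edges n s')
         else reg s' ''ans'' = 0))"
proof (rule exI[of _ lcst_program], rule exI[of _ lcst_cost], intro allI impI)
  fix n :: nat and E :: "nat set set" and h t :: "nat \<Rightarrow> complex" and s :: state
  assume "n \<ge> 3 \<and> proper_model {..<n} E h t \<and> (\<forall>v<n. density {..<n} h t v \<ge> 2) \<and> input_state n E h t s"
  then have n: "reg s ''n'' = n" and "endpoint_sequence n E h t (arr s ''own'') (arr s ''kind'')"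
    by (auto simp: endpoint_sequence_def input_state_def encodes_graph_def encodes_model_def Let_def)
  then interpret endpoint_sequence n E h t "arr s ''own''" "arr s ''kind''" by blast
  obtain k s' where "exec lcst_program s k s'" "k \<le> lcst_cost * n"
    "if \<exists>T. locally_connected_spanning_tree {..<n} E T
     then reg s' ''ans'' = 1 \<and> locally_connected_spanning_tree {..<n} E (output_edges n s')
     else reg s' ''ans'' = 0"
    using lcst_program_correct[OF n refl refl] by blast
  moreover have "lcst_cost * n \<le> lcst_cost * (n + card E)" by simp
  ultimately show "\<exists>k s'. exec lcst_program s k s' \<and> k \<le> lcst_cost * (n + card E) \<and>
      (if \<exists>T. locally_connected_spanning_tree {..<n} E T
       then reg s' ''ans'' = 1 \<and> locally_connected_spanning_tree {..<n} E (output_edges n s')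
       else reg s' ''ans'' = 0)"
    by (meson order_trans)
qed

end
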